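(* Suppose the following hold. (i) There are constants $a_0,b_0>0$, $0<\gamma_0<\frac12$ and $0<p=p(n)<1$ such that $$a_0np\le \sum_{v\in\mathcal S,\,v\ne u}p(u,v)\le\sum_{v\neq u}p(u,v)\le b_0np$$ for all vertices $u$ and all sets $\mathcal S\subseteq\{1,\dots,n\}$ containing at least $\gamma_0n$ vertices. (ii) The edge weight ccdf $F_c(x)$ is continuous for all large $x$, and the edge cost factor satisfies $$\delta_{low}\le(\mathbb E r(X_1,X_2))^2\le\mathbb E r^2(X_1,X_2)\le\delta_{up}$$ for some constants $\delta_{low},\delta_{up}>0$. Then there is a constant $\lambda>0$ such that if $p\ge\frac{\lambda\log n}{n}$, then $$\mathbb P\left(E_{con}\cap\{\chi_n\ge\lambda^{-1}nH_c(np)\}\right)\ge1-\frac{\lambda}{n}.$$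
   Context: For each integer $n\ge2$ let $K_n$ be the complete graph on $\{1,\dots,n\}$; edges $h=(u,v)$ are undirected. Let $\{Z(h)\}_{h\in K_n}$ be independent Bernoulli random variables with $\mathbb P(Z(h)=1)=p(h)=1-\mathbb P(Z(h)=0)$, $0<p(h)<1$; write $p(h)=p(u,v)=p(v,u)$. The random graph $G$ has vertex set $\{1,\dots,n\}$ and edge set $\{h:Z(h)=1\}$; $E_{con}$ is the event that $G$ is connected. Each edge $h$ has a positive random weight $W(h)=W(u,v)$, the weights being i.i.d.; each vertex $u$ has a random mark $X_u$, the marks $X_1,\dots,X_n$ being i.i.d. with values in a (measurable) set $\Omega_{mk}$. The families $\{Z(h)\}$, $\{W(h)\}$, $\{X_u\}$ are mutually independent. For a deterministic symmetric measurable function $r:\Omega_{mk}\times\Omega_{mk}\to(0,\infty)$, the cost of $h=(u,v)$ is $c(h)=c(u,v)=r(X_u,X_v)\,W(u,v)$, and $r(X_u,X_v)$ is the cost factor. The edge weight ccdf is $F_c(x)=\mathbb P(W(h)>x)$, $x>0$, and its inverse is $H_c(y)=\sup\{x>0:F_c(x)\ge 1/y\}$ for $y>1$. The cost of a tree is the sum of the costs of its edges. $\chi_n$ is the maximum cost of a spanning tree of the largest component of $G$ (ties between largest components broken by any fixed rule). The edge probabilities, the law of the marks and $r$ may depend on $n$; the law of the weights does not. "Constants" do not depend on $n$. *)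

theory Defs
  imports "HOL-Probability.Probability"
begin

text \<open>
  A simple graph is given by a vertex set and a set of edges, each edge being a
  two-element set of vertices.  (The trees of the AFP entry \<open>Graph_Theory\<close> are
  directed, and there a pair of opposite arcs already forms a cycle.)
\<close>

definition complete_edges :: "nat \<Rightarrow> nat set set" where
  "complete_edges n = {h. h \<subseteq> {1..n} \<and> card h = 2}"

definition reachable :: "'v set set \<Rightarrow> ('v \<times> 'v) set" where
  "reachable E = {(u, v). {u, v} \<in> E}\<^sup>*"

definition connected_graph :: "'v set \<Rightarrow> 'v set set \<Rightarrow> bool" where
  "connected_graph V E \<longleftrightarrow> (\<forall>u\<in>V. \<forall>v\<in>V. (u, v) \<in> reachable E)"

definition graph_components :: "'v set \<Rightarrow> 'v set set \<Rightarrow> 'v set set" where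
  "graph_components V E = {{v \<in> V. (u, v) \<in> reachable E} | u. u \<in> V}"

definition largest_component :: "'v set \<Rightarrow> 'v set set \<Rightarrow> 'v set \<Rightarrow> bool" where
  "largest_component V E C \<longleftrightarrow>
     C \<in> graph_components V E \<and> (\<forall>D\<in>graph_components V E. card D \<le> card C)"

definition cycle_in :: "'v set set \<Rightarrow> 'v list \<Rightarrow> bool" where
  "cycle_in T vs \<longleftrightarrow> 3 \<le> length vs \<and> distinct vs \<and>
     (\<forall>i<length vs. {vs ! i, vs ! (Suc i mod length vs)} \<in> T)"

definition tree_on :: "'v set \<Rightarrow> 'v set set \<Rightarrow> bool" where
  "tree_on V T \<longleftrightarrow> connected_graph V T \<and> (\<nexists>vs. cycle_in T vs)"

definition spanning_trees :: "'v set \<Rightarrow> 'v set set \<Rightarrow> 'v set set set" where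
  "spanning_trees C E = {T. T \<subseteq> {h \<in> E. h \<subseteq> C} \<and> tree_on C T}"

definition max_tree_cost :: "('v set \<Rightarrow> real) \<Rightarrow> 'v set \<Rightarrow> 'v set set \<Rightarrow> real" where
  "max_tree_cost c C E = Max ((\<lambda>T. \<Sum>h\<in>T. c h) ` spanning_trees C E)"

definition ccdf :: "real measure \<Rightarrow> real \<Rightarrow> real" where
  "ccdf \<mu> x = measure \<mu> {x<..}"

text \<open>Only meaningful for \<open>y > 1\<close>: otherwise the set may be empty or unbounded.\<close>

definition ccdf_inverse :: "real measure \<Rightarrow> real \<Rightarrow> real" where
  "ccdf_inverse \<mu> y = Sup {x. 0 < x \<and> ccdf \<mu> x \<ge> 1 / y}"

text \<open>The random graph on \<open>{1..n}\<close> and the edge costs at a single sample point.\<close>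

definition present_edges :: "nat \<Rightarrow> (nat set \<Rightarrow> 'w \<Rightarrow> nat) \<Rightarrow> 'w \<Rightarrow> nat set set" where
  "present_edges n Z \<omega> = {h \<in> complete_edges n. Z h \<omega> = 1}"

text \<open>
  For symmetric \<open>r\<close>, the value \<open>r (X\<^sub>u) (X\<^sub>v)\<close> depends only on the edge
  \<open>{u, v}\<close>; taking the endpoints in increasing order is one way to write it.
\<close>

definition edge_cost ::
  "('k \<Rightarrow> 'k \<Rightarrow> real) \<Rightarrow> (nat \<Rightarrow> 'w \<Rightarrow> 'k) \<Rightarrow> (nat set \<Rightarrow> 'w \<Rightarrow> real) \<Rightarrow> 'w \<Rightarrow> nat set \<Rightarrow> real"
where
  "edge_cost r X W \<omega> h = r (X (Min h) \<omega>) (X (Max h) \<omega>) * W h \<omega>"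

text \<open>
  \<open>tie E\<close> is the component selected by the tie-breaking rule when the edge set is \<open>E\<close>.
\<close>

definition max_spanning_cost ::
  "nat \<Rightarrow> (nat set set \<Rightarrow> nat set) \<Rightarrow> (nat set \<Rightarrow> 'w \<Rightarrow> nat) \<Rightarrow> (nat set \<Rightarrow> 'w \<Rightarrow> real)
    \<Rightarrow> (nat \<Rightarrow> 'w \<Rightarrow> 'k) \<Rightarrow> ('k \<Rightarrow> 'k \<Rightarrow> real) \<Rightarrow> 'w \<Rightarrow> real"
where
  "max_spanning_cost n tie Z W X r \<omega> =
     (let E = present_edges n Z \<omega> in max_tree_cost (edge_cost r X W \<omega>) (tie E) E)"

text \<open>
  The model for a fixed \<open>n\<close>.  Here \<open>pe {u, v}\<close> is the probability \<open>p(u, v)\<close>, \<open>\<mu>\<close> is the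
  law of the weights and \<open>MK\<close> is the measurable space of marks (only its space and its
  \<open>\<sigma>\<close>-algebra are used, not its measure).

  The predicate \<open>indep_vars\<close> needs all variables to have the same value type, so the mutual
  independence of all the \<open>Z h\<close>, \<open>W h\<close> and \<open>X u\<close> is stated with \<open>indep_sets\<close>, for the
  \<open>\<sigma>\<close>-algebras they generate, as in \<open>indep_vars_def2\<close>.
\<close>

locale weighted_random_graph = prob_space M
  for M :: "'w measure"
    and n :: nat
    and pe :: "nat set \<Rightarrow> real"
    and Z :: "nat set \<Rightarrow> 'w \<Rightarrow> nat"
    and \<mu> :: "real measure"
    and W :: "nat set \<Rightarrow> 'w \<Rightarrow> real"
    and MK :: "'k measure"
    and X :: "nat \<Rightarrow> 'w \<Rightarrow> 'k"
    and r :: "'k \<Rightarrow> 'k \<Rightarrow> real" +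
  assumes edge_prob: "h \<in> complete_edges n \<Longrightarrow> 0 < pe h \<and> pe h < 1"
    and Z_measurable: "h \<in> complete_edges n \<Longrightarrow> random_variable (count_space UNIV) (Z h)"
    and Z_one: "h \<in> complete_edges n \<Longrightarrow> prob {\<omega> \<in> space M. Z h \<omega> = 1} = pe h"
    and Z_zero: "h \<in> complete_edges n \<Longrightarrow> prob {\<omega> \<in> space M. Z h \<omega> = 0} = 1 - pe h"
    and W_measurable: "h \<in> complete_edges n \<Longrightarrow> random_variable borel (W h)"
    and W_positive: "h \<in> complete_edges n \<Longrightarrow> \<omega> \<in> space M \<Longrightarrow> 0 < W h \<omega>"
    and W_law: "h \<in> complete_edges n \<Longrightarrow> distr M borel (W h) = \<mu>"
    and X_measurable: "u \<in> {1..n} \<Longrightarrow> random_variable MK (X u)"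
    and X_identical: "u \<in> {1..n} \<Longrightarrow> v \<in> {1..n} \<Longrightarrow> distr M MK (X u) = distr M MK (X v)"
    and r_measurable: "case_prod r \<in> borel_measurable (MK \<Otimes>\<^sub>M MK)"
    and r_symmetric: "x \<in> space MK \<Longrightarrow> y \<in> space MK \<Longrightarrow> r x y = r y x"
    and r_positive: "x \<in> space MK \<Longrightarrow> y \<in> space MK \<Longrightarrow> 0 < r x y"
    and independent:
      "indep_sets
         (case_sum (\<lambda>h. {Z h -` A \<inter> space M | A. A \<in> sets (count_space UNIV)})
           (case_sum (\<lambda>h. {W h -` A \<inter> space M | A. A \<in> sets borel})
                     (\<lambda>u. {X u -` A \<inter> space M | A. A \<in> sets MK})))
         (complete_edges n <+> complete_edges n <+> {1..n})"

end

theory Submission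
  imports Defs
begin

text \<open>
  Put \<open>y = n p\<close>, \<open>H = H\<^sub>c(y)\<close>, split the vertices into halves \<open>A\<close> and \<open>B\<close>, and call an edge
  \<open>{u, v}\<close> with \<open>u \<in> A\<close>, \<open>v \<in> B\<close> good if it is present, its weight exceeds \<open>H / 2\<close> (which has
  probability at least \<open>1 / y\<close>) and its cost factor exceeds a small constant (which, by
  Paley and Zygmund, has probability bounded below).  The good edges chosen one for each
  vertex of \<open>A\<close> that has any form a star forest; it extends to a spanning tree of the
  connected graph, so it suffices that linearly many vertices of \<open>A\<close> have a good edge.

  Chebyshev's inequality gives this twice, each time with error \<open>O(1 / n)\<close>.  First, the total
  edge probability carried by the pairs with a large cost factor is of order \<open>n y\<close>, because
  two pairs without a common vertex are independent.  Second, given the marks, the vertices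
  of \<open>A\<close> have good edges independently of each other; here the marks enter only through the
  finite bipartite graph of pairs with a large cost factor, so conditioning is a finite sum.
  Connectedness follows from a union bound over cuts.
\<close>

section \<open>Spanning trees\<close>

lemma reachable_sym: "(u, v) \<in> reachable E \<Longrightarrow> (v, u) \<in> reachable E"
  unfolding reachable_def
  by (metis (mono_tags, lifting) case_prod_conv insert_commute mem_Collect_eq rtrancl_converseD
      rtrancl_converseI symI sym_conv_converse_eq)

lemma reachable_trans: "(u, v) \<in> reachable E \<Longrightarrow> (v, w) \<in> reachable E \<Longrightarrow> (u, w) \<in> reachable E"
  unfolding reachable_def by (rule rtrancl_trans)

lemma reachable_refl [simp]: "(u, u) \<in> reachable E"
  unfolding reachable_def by simp

lemma reachable_edge: "{u, v} \<in> E \<Longrightarrow> (u, v) \<in> reachable E"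
  unfolding reachable_def by auto

lemma reachable_subset:
  assumes "\<And>u v. {u, v} \<in> E \<Longrightarrow> (u, v) \<in> reachable T"
  shows "reachable E \<subseteq> reachable T"
proof clarify
  fix u v assume "(u, v) \<in> reachable E"
  then have "(u, v) \<in> {(u, v). {u, v} \<in> E}\<^sup>*" by (simp add: reachable_def)
  then show "(u, v) \<in> reachable T"
    by induction (auto intro: assms reachable_trans)
qed

text \<open>The walk is a function on all of \<open>nat\<close>, so that a cycle can be followed
  past the end of its vertex list by reducing indices modulo the length.\<close>

lemma reachable_list:
  assumes "\<And>j. i \<le> j \<Longrightarrow> j < k \<Longrightarrow> {vs j, vs (Suc j)} \<in> T" "i \<le> k"
  shows "(vs i, vs k) \<in> reachable T"
proof -
  have "k' \<le> k \<Longrightarrow> (vs i, vs k') \<in> reachable T" if "i \<le> k'" for k'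
    using that
  proof (induction rule: dec_induct)
    case (step m)
    then have "(vs m, vs (Suc m)) \<in> reachable T" by (intro reachable_edge assms(1)) auto
    moreover have "(vs i, vs m) \<in> reachable T" using step by simp
    ultimately show ?case by (rule reachable_trans[rotated])
  qed simp
  then show ?thesis using assms(2) by simp
qed

text \<open>The predecessor and the successor of \<open>x\<close> on the cycle differ because the
  cycle has at least three vertices.\<close>

lemma cycle_two_neighbours:
  assumes "cycle_in T vs" "x \<in> set vs"
  obtains a b where "a \<noteq> b" "{x, a} \<in> T" "{x, b} \<in> T"
proof -
  let ?l = "length vs"
  obtain i where i: "i < ?l" "x = vs ! i" using assms(2) by (metis in_set_conv_nth)
  have l: "3 \<le> ?l" "distinct vs" and e: "\<And>i. i < ?l \<Longrightarrow> {vs ! i, vs ! (Suc i mod ?l)} \<in> T"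
    using assms(1) by (auto simp: cycle_in_def)
  \<comment> \<open>The cyclic predecessor of \<open>i\<close>, which wraps around at
    \<open>0\<close>.\<close>
  define j where "j = (if i = 0 then ?l - 1 else i - 1)"
  have l0: "0 < ?l" using l by linarith
  have j: "j < ?l" "Suc j mod ?l = i"
    using i l0 by (cases "i = 0"; simp add: j_def)+
  have ne: "Suc i mod ?l \<noteq> j"
  proof (cases "Suc i = ?l")
    case False
    then have "Suc i mod ?l = Suc i" by (intro mod_less) (use i in linarith)
    then show ?thesis using False l by (cases "i = 0") (auto simp: j_def)
  qed (use l in \<open>simp add: j_def\<close>)
  have "Suc i mod ?l < ?l" by (rule mod_less_divisor) (use i in linarith)
  then have "vs ! (Suc i mod ?l) \<noteq> vs ! j" using ne j l by (simp add: nth_eq_iff_index_eq)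
  moreover have "{x, vs ! j} \<in> T" using e[of j] j i by (simp add: insert_commute)
  ultimately show ?thesis using that e[of i] i by blast
qed

text \<open>Every edge meets \<open>A\<close>, so a cycle would pass through some \<open>x\<close>
  in \<open>A\<close>. Since \<open>f\<close> never lands in \<open>A\<close>, the only edge at
  \<open>x\<close> is \<open>{x, f x}\<close>, while a cycle needs two.\<close>

lemma star_forest_acyclic:
  assumes "\<And>u. u \<in> A \<Longrightarrow> f u \<notin> A"
  shows "\<not> cycle_in ((\<lambda>u. {u, f u}) ` A) vs"
proof
  let ?F = "(\<lambda>u. {u, f u}) ` A"
  assume c: "cycle_in ?F vs"
  then have "0 < length vs" by (auto simp: cycle_in_def)
  then have "{vs ! 0, vs ! (Suc 0 mod length vs)} \<in> ?F" using c unfolding cycle_in_def by blast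
  moreover have "Suc 0 mod length vs < length vs"
    by (rule mod_less_divisor) (use \<open>0 < length vs\<close> in simp)
  ultimately obtain x where x: "x \<in> set vs" "x \<in> A"
    using nth_mem[OF \<open>0 < length vs\<close>] nth_mem[of "Suc 0 mod length vs" vs]
    by (smt (verit) doubleton_eq_iff imageE)
  have "a = f x" if "{x, a} \<in> ?F" for a
    using that x assms by (auto simp: doubleton_eq_iff)
  then show False using cycle_two_neighbours[OF c x(1)] by metis
qed

text \<open>A cycle in the enlarged set must use the new edge; the rest of the cycle is then a walk
  from one end to the other inside \<open>T\<close>, contrary to \<open>nr\<close>.\<close>

lemma acyclic_insert_edge:
  assumes acyc: "\<nexists>vs. cycle_in T vs" and nr: "(u, v) \<notin> reachable T"
  shows "\<nexists>vs. cycle_in (insert {u, v} T) vs"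
proof
  assume "\<exists>vs. cycle_in (insert {u, v} T) vs"
  then obtain vs where c: "cycle_in (insert {u, v} T) vs" ..
  let ?l = "length vs" and ?g = "\<lambda>i. vs ! (i mod length vs)"
  have l: "3 \<le> ?l" and d: "distinct vs"
    and e: "\<And>i. i < ?l \<Longrightarrow> {vs ! i, vs ! (Suc i mod ?l)} \<in> insert {u, v} T"
    using c by (auto simp: cycle_in_def)
  have l0: "?l > 0" using l by linarith
  have e': "{?g i, ?g (Suc i)} \<in> insert {u, v} T" for i
    using e[of "i mod ?l"] l0 by (simp add: mod_Suc_eq)
  have inj: "?g i = ?g j \<longleftrightarrow> i mod ?l = j mod ?l" for i j
    using d l0 by (simp add: nth_eq_iff_index_eq)
  obtain i where i: "i < ?l" "{vs ! i, vs ! (Suc i mod ?l)} \<notin> T"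
    using acyc l d by (auto simp: cycle_in_def)
  then have iuv: "{?g i, ?g (Suc i)} = {u, v}" using e[of i] by auto
  \<comment> \<open>On the way around from position \<open>i + 1\<close> to \<open>i + ?l\<close> no
    edge repeats the one at position \<open>i\<close>, so each lies in \<open>T\<close>.\<close>
  have "{?g j, ?g (Suc j)} \<in> T" if j: "Suc i \<le> j" "j < i + ?l" for j
  proof -
    have "{?g j, ?g (Suc j)} \<noteq> {?g i, ?g (Suc i)}"
    proof
      assume eq: "{?g j, ?g (Suc j)} = {?g i, ?g (Suc i)}"
      define k where "k = j - i"
      have k: "j = i + k" "0 < k" "k < ?l" using j by (auto simp: k_def)
      have i_mod: "i mod ?l = i" using i(1) by (rule mod_less)
      have "j mod ?l \<noteq> i mod ?l"
      proof (cases "j < ?l")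
        case True
        then have "j mod ?l = j" by (rule mod_less)
        then show ?thesis using k i_mod by linarith
      next
        case False
        then have "j mod ?l = (j - ?l) mod ?l" by (intro le_mod_geq) linarith
        also have "\<dots> = j - ?l" by (rule mod_less) (use k i in linarith)
        finally have "j mod ?l = j - ?l" .
        then show ?thesis using k i_mod i(1) False by linarith
      qed
      \<comment> \<open>Meeting the same edge backwards would force \<open>i + 2\<close> and
        \<open>i\<close> to agree modulo the length, impossible for length at least 3.\<close>
      moreover have "\<not> (j mod ?l = Suc i mod ?l \<and> Suc j mod ?l = i mod ?l)"
      proof
        assume a: "j mod ?l = Suc i mod ?l \<and> Suc j mod ?l = i mod ?l"
        then have eq: "Suc (Suc i) mod ?l = i" using i_mod by (metis mod_Suc_eq)
        show False
        proof (cases "Suc (Suc i) < ?l")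
          case True
          then have "Suc (Suc i) mod ?l = Suc (Suc i)" by (rule mod_less)
          then show ?thesis using eq by linarith
        next
          case False
          then have "Suc (Suc i) mod ?l = (Suc (Suc i) - ?l) mod ?l" by (intro le_mod_geq) linarith
          also have "\<dots> = Suc (Suc i) - ?l" by (rule mod_less) (use i l in linarith)
          finally show ?thesis using eq i l False by linarith
        qed
      qed
      ultimately show False using eq unfolding doubleton_eq_iff inj by blast
    qed
    then show ?thesis using e'[of j] iuv by (metis insertE)
  qed
  then have "(?g (Suc i), ?g (i + ?l)) \<in> reachable T"
    by (intro reachable_list[of "Suc i" "i + ?l" ?g], blast) (use l in linarith)+
  then have "(?g (Suc i), ?g i) \<in> reachable T" by (simp only: mod_add_self2)
  then show False using iuv nr by (metis doubleton_eq_iff reachable_sym)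
qed

text \<open>A maximal acyclic \<open>T\<close> between \<open>F\<close> and \<open>E\<close> works:
  if the ends of an edge of \<open>E\<close> were not joined in \<open>T\<close>, that edge could be
  added without creating a cycle.\<close>

lemma acyclic_extends_to_spanning_tree:
  assumes "finite E" "F \<subseteq> E" "\<Union>E \<subseteq> V" "connected_graph V E" "\<nexists>vs. cycle_in F vs"
  obtains T where "F \<subseteq> T" "T \<in> spanning_trees V E"
proof -
  define S where "S = {T. F \<subseteq> T \<and> T \<subseteq> E \<and> (\<nexists>vs. cycle_in T vs)}"
  have "S \<subseteq> Pow E" by (auto simp: S_def)
  then have "finite S" using assms(1) by (simp add: finite_subset)
  moreover have "F \<in> S" using assms(2,5) by (simp add: S_def)
  ultimately obtain T where T: "T \<in> S" and mx: "\<And>T'. T' \<in> S \<Longrightarrow> T \<subseteq> T' \<Longrightarrow> T = T'"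
    using finite_has_maximal2[of S F] by auto
  have T': "F \<subseteq> T" "T \<subseteq> E" "\<nexists>vs. cycle_in T vs" using T by (simp_all add: S_def)
  have "(u, v) \<in> reachable T" if uv: "{u, v} \<in> E" for u v
  proof (rule ccontr)
    assume nr: "(u, v) \<notin> reachable T"
    have "insert {u, v} T \<in> S"
      unfolding S_def using acyclic_insert_edge[OF T'(3) nr] T'(1,2) uv by simp blast
    then have "T = insert {u, v} T" by (rule mx) (rule subset_insertI)
    then have "{u, v} \<in> T" by (metis insertI1)
    then show False using nr reachable_edge by metis
  qed
  then have "reachable E \<subseteq> reachable T" by (rule reachable_subset)
  then have "connected_graph V T" using assms(4) unfolding connected_graph_def by (meson subsetD)
  moreover have "T \<subseteq> {h \<in> E. h \<subseteq> V}" using T'(2) assms(3) by (simp add: subset_iff) blast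
  ultimately have "T \<in> spanning_trees V E"
    using T'(3) by (simp add: spanning_trees_def tree_on_def)
  then show ?thesis using T'(1) that by metis
qed

section \<open>Components and cuts\<close>

lemma connected_largest_component:
  assumes "connected_graph V E" "largest_component V E C"
  shows "C = V"
proof -
  obtain u where "u \<in> V" "C = {v \<in> V. (u, v) \<in> reachable E}"
    using assms(2) unfolding largest_component_def graph_components_def by blast
  then show ?thesis using assms(1) unfolding connected_graph_def by blast
qed

text \<open>Take the component of a vertex or its complement, whichever is smaller. The other side
  then has at least half of all vertices, so the lower bound on edge sums applies to it.\<close>

lemma disconnected_cut:
  assumes "finite V" "\<not> connected_graph V E"
  obtains S where "S \<subseteq> V" "S \<noteq> {}" "2 * card S \<le> card V" "\<And>u v. u \<in> S \<Longrightarrow> v \<in> V - S \<Longrightarrow> {u, v} \<notin> E"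
proof -
  obtain u v where uv: "u \<in> V" "v \<in> V" "(u, v) \<notin> reachable E"
    using assms by (auto simp: connected_graph_def)
  define R where "R = {w \<in> V. (u, w) \<in> reachable E}"
  have R: "R \<subseteq> V" "R \<noteq> {}" "V - R \<noteq> {}" using uv by (auto simp: R_def)
  have cut: "{x, y} \<notin> E" if "x \<in> R" "y \<in> V - R" for x y
    using that reachable_edge[of x y E] reachable_trans[of u x E y] by (auto simp: R_def)
  have "card (V - R) = card V - card R" "card R \<le> card V"
    using R assms(1) by (metis card_Diff_subset finite_subset) (use R assms(1) in \<open>metis card_mono\<close>)
  then consider "2 * card R \<le> card V" | "2 * card (V - R) \<le> card V" by linarith
  then show ?thesis
  proof cases
    case 1
    then show ?thesis using that[of R] R cut by blast
  next
    case 2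
    have "V - (V - R) = R" using R by auto
    moreover have "{x, y} \<notin> E" if "x \<in> V - R" "y \<in> R" for x y
      using cut[OF that(2,1)] by (metis insert_commute)
    ultimately show ?thesis using that[of "V - R"] 2 R by blast
  qed
qed

lemma finite_spanning_trees: "finite E \<Longrightarrow> finite (spanning_trees V E)"
  by (rule finite_subset[of _ "Pow E"]) (auto simp: spanning_trees_def)

section \<open>Auxiliary estimates\<close>

text \<open>Chebyshev's inequality. The relation \<open>D\<close> holds the pairs that may be
  dependent: off \<open>D\<close> covariances vanish, and on \<open>D\<close> they are at most 1, so
  \<open>V\<close> bounds the variance.\<close>

lemma (in prob_space) weighted_indicator_lower_tail:
  assumes fin: "finite I" and ev: "\<And>i. i \<in> I \<Longrightarrow> A i \<in> events" and c: "\<And>i. i \<in> I \<Longrightarrow> 0 \<le> c i"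
    and ind: "\<And>i j. i \<in> I \<Longrightarrow> j \<in> I \<Longrightarrow> (i, j) \<notin> D \<Longrightarrow> prob (A i \<inter> A j) = prob (A i) * prob (A j)"
    and m: "0 < m" "m \<le> (\<Sum>i\<in>I. c i * prob (A i))"
    and V: "(\<Sum>(i, j)\<in>(I \<times> I) \<inter> D. c i * c j) \<le> V"
  shows "prob {\<omega> \<in> space M. (\<Sum>i\<in>I. c i * indicator (A i) \<omega>) \<le> m / 2} \<le> 4 * V / m\<^sup>2"
proof -
  define f where "f \<omega> = (\<Sum>i\<in>I. c i * indicator (A i) \<omega>)" for \<omega>
  have f[measurable]: "f \<in> borel_measurable M"
    unfolding f_def using ev by measurable
  have int: "integrable M (\<lambda>\<omega>. k * indicator B \<omega> :: real)" if "B \<in> events" for B k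
    using that by (intro integrable_mult_right integrable_real_indicator) (auto simp: emeasure_eq_measure)
  have sq: "(f \<omega>)\<^sup>2 = (\<Sum>(i, j)\<in>I \<times> I. c i * c j * indicator (A i \<inter> A j) \<omega>)" for \<omega>
    by (simp add: f_def power2_eq_square sum_product sum.cartesian_product indicator_inter_arith mult_ac)
  have int_f: "integrable M f" unfolding f_def by (intro Bochner_Integration.integrable_sum int ev)
  have int_sq: "integrable M (\<lambda>\<omega>. (f \<omega>)\<^sup>2)" unfolding sq case_prod_beta
    by (intro Bochner_Integration.integrable_sum) (intro int sets.Int ev; simp add: mem_Times_iff)
  have int_one: "expectation (\<lambda>\<omega>. k * indicator B \<omega>) = k * prob B" if "B \<in> events" for B k
    using that by simp
  have Ef: "expectation f = (\<Sum>i\<in>I. c i * prob (A i))"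
    unfolding f_def
    by (rule trans[OF Bochner_Integration.integral_sum sum.cong[OF refl]]) (intro int int_one ev, assumption)+
  have Esq: "expectation (\<lambda>\<omega>. (f \<omega>)\<^sup>2) = (\<Sum>(i, j)\<in>I \<times> I. c i * c j * prob (A i \<inter> A j))"
    unfolding sq case_prod_beta mem_Times_iff
    by (rule trans[OF Bochner_Integration.integral_sum sum.cong[OF refl]])
      (intro int int_one sets.Int ev; simp add: mem_Times_iff)+
  have "variance f = expectation (\<lambda>\<omega>. (f \<omega>)\<^sup>2) - (expectation f)\<^sup>2"
    by (rule variance_eq[OF int_f int_sq])
  also have "\<dots> = (\<Sum>(i, j)\<in>I \<times> I. c i * c j * (prob (A i \<inter> A j) - prob (A i) * prob (A j)))"
    unfolding Ef Esq
    by (simp add: power2_eq_square sum_product sum.cartesian_product sum_subtractf[symmetric]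
        algebra_simps case_prod_beta)
  also have "\<dots> = (\<Sum>(i, j)\<in>(I \<times> I) \<inter> D. c i * c j * (prob (A i \<inter> A j) - prob (A i) * prob (A j)))"
    using fin by (intro sum.mono_neutral_right) (auto intro: ind)
  also have "\<dots> \<le> (\<Sum>(i, j)\<in>(I \<times> I) \<inter> D. c i * c j)"
  proof (intro sum_mono, clarify)
    fix i j assume "i \<in> I" "j \<in> I"
    moreover have "prob (A i \<inter> A j) - prob (A i) * prob (A j) \<le> 1"
      using prob_le_1[of "A i \<inter> A j"] by (smt (verit) mult_nonneg_nonneg measure_nonneg)
    ultimately show "c i * c j * (prob (A i \<inter> A j) - prob (A i) * prob (A j)) \<le> c i * c j"
      using c by (intro mult_left_le) auto
  qed
  finally have var: "variance f \<le> V" using V by linarith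
  \<comment> \<open>The mean is at least \<open>m\<close>, so a value of at most
    \<open>m / 2\<close> deviates from it by at least \<open>m / 2\<close>.\<close>
  have "prob {\<omega> \<in> space M. f \<omega> \<le> m / 2} \<le> prob {\<omega> \<in> space M. \<bar>f \<omega> - expectation f\<bar> \<ge> m / 2}"
    using m unfolding Ef[symmetric] by (intro finite_measure_mono) auto
  also have "\<dots> \<le> variance f / (m / 2)\<^sup>2"
    using m int_sq by (intro Chebyshev_inequality) auto
  also have "\<dots> \<le> V / (m / 2)\<^sup>2" using var by (intro divide_right_mono) auto
  also have "\<dots> = 4 * V / m\<^sup>2" by (simp add: power_divide)
  finally show ?thesis unfolding f_def .
qed

lemma prod_one_minus_le_exp:
  fixes f :: "'a \<Rightarrow> real"
  assumes "\<And>x. x \<in> H \<Longrightarrow> f x \<le> 1"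
  shows "(\<Prod>x\<in>H. 1 - f x) \<le> exp (- (\<Sum>x\<in>H. f x))"
\<comment> \<open>For infinite \<open>H\<close> both sides equal 1, since the product then defaults
  to 1 and the sum to 0.\<close>
proof (cases "finite H")
  case True
  have "(\<Prod>x\<in>H. 1 - f x) \<le> (\<Prod>x\<in>H. exp (- f x))"
  proof (intro prod_mono conjI)
    fix x
    show "1 - f x \<le> exp (- f x)" using exp_ge_add_one_self[of "- f x"] by simp
  qed (use assms in auto)
  also have "\<dots> = exp (- (\<Sum>x\<in>H. f x))" using True by (simp add: exp_sum[symmetric] sum_negf)
  finally show ?thesis .
qed simp

text \<open>From \<open>exp (- x) \<le> 1 / (1 + x)\<close>. It turns an exponential bound for the
  absence of good edges into a lower bound linear in their expected number, as long as that number
  stays bounded.\<close>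

lemma one_minus_exp_ge:
  fixes x b :: real
  assumes "0 \<le> x" "x \<le> b"
  shows "x / (1 + b) \<le> 1 - exp (- x)"
proof -
  have "exp (- x) \<le> 1 / (1 + x)"
    using exp_ge_add_one_self[of x] assms by (simp add: exp_minus field_simps)
  then have "x / (1 + x) \<le> 1 - exp (- x)" using assms by (simp add: field_simps)
  moreover have "x / (1 + b) \<le> x / (1 + x)" using assms by (intro divide_left_mono) auto
  ultimately show ?thesis by linarith
qed

text \<open>With \<open>m = sqrt l\<close>, values of \<open>f\<close> below \<open>m / 2\<close>
  contribute at most \<open>m / 2\<close> to a mean of at least \<open>m\<close>. The rest comes
  from the event in question, and the bounded second moment keeps that event from being too
  unlikely.\<close>

lemma (in prob_space) paley_zygmund_half:
  fixes f :: "'a \<Rightarrow> real"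
  assumes f [measurable]: "f \<in> borel_measurable M" and pos: "\<And>\<omega>. \<omega> \<in> space M \<Longrightarrow> 0 \<le> f \<omega>"
    and int: "integrable M (\<lambda>\<omega>. (f \<omega>)\<^sup>2)"
    and l: "0 < l" "l \<le> (expectation f)\<^sup>2" and U: "expectation (\<lambda>\<omega>. (f \<omega>)\<^sup>2) \<le> U"
  shows "l / (4 * U) \<le> prob {\<omega> \<in> space M. sqrt l / 2 \<le> f \<omega>}"
proof -
  let ?A = "{\<omega> \<in> space M. sqrt l / 2 \<le> f \<omega>}"
  define m where "m = sqrt l"
  have m: "0 < m" "m\<^sup>2 = l" using l by (simp_all add: m_def)
  have int_f: "integrable M f" by (rule square_integrable_imp_integrable[OF f int])
  have "0 \<le> expectation f" using pos by (intro integral_nonneg_AE) auto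
  then have Ef: "m \<le> expectation f" unfolding m_def using l(2) by (intro real_le_lsqrt) auto
  have "variance f = expectation (\<lambda>\<omega>. (f \<omega>)\<^sup>2) - (expectation f)\<^sup>2"
    by (rule variance_eq[OF int_f int])
  \<comment> \<open>Hence \<open>U\<close> is at least \<open>l\<close>, so it is positive and can
    be divided by.\<close>
  moreover have "0 \<le> variance f" by (rule integral_nonneg_AE) simp
  ultimately have U0: "0 < U" using l U by linarith
  \<comment> \<open>This \<open>e\<close> makes \<open>(e / 2) * U\<close> equal to
    \<open>m / 4\<close> and gives the best constant, the one of Cauchy-Schwarz.\<close>
  define e where "e = m / (2 * U)"
  have e: "0 < e" using m U0 by (simp add: e_def)
  have int_A: "integrable M (indicator ?A :: _ \<Rightarrow> real)"
    by (intro integrable_real_indicator) (auto simp: emeasure_eq_measure)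
  have "expectation f \<le> expectation (\<lambda>\<omega>. m / 2 + (e / 2) * (f \<omega>)\<^sup>2 + (1 / (2 * e)) * indicator ?A \<omega>)"
  proof (intro integral_mono int_f Bochner_Integration.integrable_add integrable_mult_right int int_A)
    fix \<omega> assume w: "\<omega> \<in> space M"
    \<comment> \<open>AM-GM in place of the Cauchy-Schwarz inequality for \<open>E (f 1\<^sub>A)\<close>\<close>
    have "0 \<le> (e * f \<omega> - 1)\<^sup>2 / (2 * e)" using e by simp
    also have "\<dots> = (e / 2) * (f \<omega>)\<^sup>2 + 1 / (2 * e) - f \<omega>" using e by (simp add: power2_eq_square field_simps)
    finally have "f \<omega> \<le> (e / 2) * (f \<omega>)\<^sup>2 + 1 / (2 * e)" by linarith
    moreover have "0 \<le> (e / 2) * (f \<omega>)\<^sup>2" using e by simp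
    moreover have "f \<omega> < m / 2 \<and> (1 / (2 * e)) * indicator ?A \<omega> = 0 \<or> (1 / (2 * e)) * indicator ?A \<omega> = 1 / (2 * e)"
      using w by (cases "\<omega> \<in> ?A") (auto simp: m_def)
    ultimately show "f \<omega> \<le> m / 2 + (e / 2) * (f \<omega>)\<^sup>2 + (1 / (2 * e)) * indicator ?A \<omega>"
      using m(1) by linarith
  qed simp
  also have "\<dots> = m / 2 + (e / 2) * expectation (\<lambda>\<omega>. (f \<omega>)\<^sup>2) + (1 / (2 * e)) * prob ?A"
    using int int_A by (simp add: prob_space)
  also have "\<dots> \<le> m / 2 + (e / 2) * U + (1 / (2 * e)) * prob ?A"
    using U e by simp
  also have "(e / 2) * U = m / 4" using U0 by (simp add: e_def)
  finally have "m / 4 \<le> (1 / (2 * e)) * prob ?A" using Ef by linarith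
  then have "m * e / 2 \<le> prob ?A" using e by (simp add: field_simps)
  moreover have "m * e / 2 = l / (4 * U)" using m(2) by (simp add: e_def power2_eq_square)
  ultimately show ?thesis by simp
qed

text \<open>Expands the product of \<open>1 + x\<close> over \<open>V\<close>; it evaluates the
  union bound over cuts.\<close>

lemma sum_power_card_Pow:
  fixes x :: real
  assumes "finite V"
  shows "(\<Sum>S\<in>Pow V. x ^ card S) = (1 + x) ^ card V"
  using prod_add[OF assms, of "\<lambda>_. x" "\<lambda>_. 1"] by (simp add: add.commute)

lemma inj_on_doubleton: "S \<inter> T = {} \<Longrightarrow> inj_on (\<lambda>(u, v). {u, v}) (S \<times> T)"
  by (auto simp: inj_on_def doubleton_eq_iff)

lemma edge_in_complete: "u \<in> {1..n} \<Longrightarrow> v \<in> {1..n} \<Longrightarrow> u \<noteq> v \<Longrightarrow> {u, v} \<in> complete_edges n"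
  by (simp add: complete_edges_def)

lemma finite_complete_edges: "finite (complete_edges n)"
  by (rule finite_subset[of _ "Pow {1..n}"]) (auto simp: complete_edges_def)

text \<open>At \<open>H\<^sub>c(y)\<close> itself the ccdf may drop below \<open>1 / y\<close>.\<close>

lemma ccdf_inverse_half:
  assumes "real_distribution \<mu>" and pos: "measure \<mu> {..0} = 0" and y: "1 < y"
  shows "0 < ccdf_inverse \<mu> y" "1 / y \<le> ccdf \<mu> (ccdf_inverse \<mu> y / 2)"
proof -
  interpret real_distribution \<mu> by fact
  let ?S = "{x. 0 < x \<and> ccdf \<mu> x \<ge> 1 / y}"
  have ccdf: "ccdf \<mu> x = 1 - cdf \<mu> x" for x
  proof -
    have "{x<..} = space \<mu> - {..x}" by auto
    then show ?thesis unfolding ccdf_def cdf_def by (subst prob_compl[symmetric]) auto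
  qed
  have y': "0 < 1 - 1 / y" using y by simp
  \<comment> \<open>There is no mass on \<open>{..0}\<close>, so right continuity at 0 gives a
    positive \<open>x0\<close> in \<open>?S\<close>.\<close>
  have "(cdf \<mu> \<longlongrightarrow> 0) (at_right 0)"
    using cdf_is_right_cont[of 0] pos by (simp add: continuous_within cdf_def)
  then have "\<forall>\<^sub>F x in at_right 0. cdf \<mu> x < 1 - 1 / y" using y' by (rule order_tendstoD)
  moreover have "\<forall>\<^sub>F x in at_right (0::real). 0 < x" by (rule eventually_at_right_less)
  ultimately have "\<forall>\<^sub>F x in at_right 0. cdf \<mu> x < 1 - 1 / y \<and> 0 < x" by (rule eventually_conj)
  then obtain x0 where "cdf \<mu> x0 < 1 - 1 / y" "0 < x0"
    using eventually_happens[of _ "at_right (0::real)"] trivial_limit_at_right_real by blast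
  then have x0: "x0 \<in> ?S" by (simp add: ccdf)
  \<comment> \<open>The ccdf tends to 0, so \<open>?S\<close> is bounded above and its supremum is
    genuine.\<close>
  have "\<forall>\<^sub>F x in at_top. 1 - 1 / y < cdf \<mu> x"
    using cdf_lim_at_top_prob by (rule order_tendstoD) (use y in simp)
  then obtain b where b: "\<And>x. b \<le> x \<Longrightarrow> 1 - 1 / y < cdf \<mu> x" by (auto simp: eventually_at_top_linorder)
  have bdd: "bdd_above ?S"
  proof (rule bdd_aboveI[of _ b])
    fix x assume "x \<in> ?S"
    then have "\<not> 1 - 1 / y < cdf \<mu> x" by (simp add: ccdf)
    then show "x \<le> b" using b[of x] by linarith
  qed
  have "x0 \<le> ccdf_inverse \<mu> y" unfolding ccdf_inverse_def using x0 bdd by (rule cSup_upper)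
  then show H: "0 < ccdf_inverse \<mu> y" using x0 by simp
  then have "ccdf_inverse \<mu> y / 2 < Sup ?S" by (simp add: ccdf_inverse_def)
  \<comment> \<open>Half of a positive supremum lies strictly below it, so a member of
    \<open>?S\<close> exceeds it; the ccdf is nonincreasing.\<close>
  then obtain x where x: "x \<in> ?S" "ccdf_inverse \<mu> y / 2 < x" using less_cSupE x0 by blast
  then have "cdf \<mu> (ccdf_inverse \<mu> y / 2) \<le> cdf \<mu> x" by (intro cdf_nondecreasing) simp
  then show "1 / y \<le> ccdf \<mu> (ccdf_inverse \<mu> y / 2)" using x(1) by (simp add: ccdf)
qed

text \<open>By \<open>(1 + x) ^ n \<le> exp (n * x) \<le> exp (1 / n)\<close>. With
  \<open>x = exp (- s)\<close> and \<open>s \<ge> 2 * ln n\<close> it makes the union bound over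
  cuts of order \<open>1 / n\<close>.\<close>

lemma one_plus_power_minus_one_le:
  assumes "0 < n" "0 \<le> x" "x \<le> 1 / (real n)\<^sup>2"
  shows "(1 + x) ^ n - 1 \<le> 2 / real n"
proof -
  have n: "0 < real n" "1 \<le> real n" using assms by simp_all
  have "(1 + x) ^ n \<le> exp x ^ n" using assms exp_ge_add_one_self[of x] by (intro power_mono) auto
  also have "\<dots> = exp (n * x)" by (simp add: exp_of_nat_mult)
  also have "\<dots> \<le> exp (1 / n)"
    using mult_left_mono[OF assms(3), of "real n"] n by (simp add: power2_eq_square)
  also have "\<dots> \<le> 1 + 1 / n + (1 / n)\<^sup>2" using n by (intro exp_bound) auto
  also have "(1 / n)\<^sup>2 \<le> 1 / real n" using n by (simp add: power2_eq_square field_simps)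
  finally show ?thesis by simp
qed

section \<open>Independence\<close>

lemma Int_stable_vimages: "Int_stable {f -` A \<inter> S | A. A \<in> sets N}"
proof (rule Int_stableI, clarify)
  fix A B assume "A \<in> sets N" "B \<in> sets N"
  then have "(f -` A \<inter> S) \<inter> (f -` B \<inter> S) = f -` (A \<inter> B) \<inter> S \<and> A \<inter> B \<in> sets N"
    by auto
  then show "\<exists>C. (f -` A \<inter> S) \<inter> (f -` B \<inter> S) = f -` C \<inter> S \<and> C \<in> sets N" ..
qed

context weighted_random_graph
begin

abbreviation var_index :: "(nat set + nat set + nat) set" where
  "var_index \<equiv> complete_edges n <+> complete_edges n <+> {1..n}"

definition var_sets :: "nat set + nat set + nat \<Rightarrow> 'w set set" where
  "var_sets = case_sum (\<lambda>h. {Z h -` A \<inter> space M | A. A \<in> sets (count_space UNIV)})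
           (case_sum (\<lambda>h. {W h -` A \<inter> space M | A. A \<in> sets borel})
                     (\<lambda>u. {X u -` A \<inter> space M | A. A \<in> sets MK}))"

text \<open>The information carried by the variables indexed by \<open>K\<close>, packaged as a
  measure on the points of \<open>M\<close> so that the measurability prover applies to it.\<close>

definition group_sigma :: "(nat set + nat set + nat) set \<Rightarrow> 'w measure" where
  "group_sigma K = sigma (space M) (\<Union>i\<in>K. var_sets i)"

lemma var_sets_subset: "(\<Union>i\<in>K. var_sets i) \<subseteq> Pow (space M)"
  by (auto simp: var_sets_def split: sum.splits)

lemma space_group_sigma [simp]: "space (group_sigma K) = space M"
  using var_sets_subset by (simp add: group_sigma_def space_measure_of)

lemma sets_group_sigma: "sets (group_sigma K) = sigma_sets (space M) (\<Union>i\<in>K. var_sets i)"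
  using var_sets_subset by (simp add: group_sigma_def sets_measure_of)

text \<open>Preimage families are intersection-stable, so independence of the single variables
  passes to the sigma-algebras generated by disjoint groups of them.\<close>

lemma indep_groups:
  assumes "disjoint_family_on K J" "\<And>j. j \<in> J \<Longrightarrow> K j \<subseteq> var_index"
  shows "indep_sets (\<lambda>j. sets (group_sigma (K j))) J"
  unfolding sets_group_sigma
proof (rule indep_sets_collect_sigma)
  show "indep_sets var_sets (\<Union>j\<in>J. K j)"
    using independent unfolding var_sets_def[symmetric]
    by (rule indep_sets_mono_index[rotated]) (use assms(2) in blast)
  show "Int_stable (var_sets i)" for i
  proof (cases i)
    case (Inr j)
    then show ?thesis by (cases j) (simp_all only: var_sets_def sum.case Int_stable_vimages)
  qed (simp only: var_sets_def sum.case Int_stable_vimages)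
qed (fact assms)

text \<open>Independence of a family includes that its sets are events, and a family of one group is
  trivially disjoint.\<close>

lemma group_sigma_events: "K \<subseteq> var_index \<Longrightarrow> sets (group_sigma K) \<subseteq> events"
  using indep_groups[of "\<lambda>_. K" "{()}"] by (auto simp: indep_sets_def disjoint_family_on_def)

lemma prob_Int_groups:
  assumes "K \<inter> L = {}" "K \<subseteq> var_index" "L \<subseteq> var_index" "A \<in> sets (group_sigma K)" "B \<in> sets (group_sigma L)"
  shows "prob (A \<inter> B) = prob A * prob B"
proof -
  have "indep_sets (\<lambda>j. sets (group_sigma (case_bool K L j))) UNIV"
    using assms(1-3) by (intro indep_groups) (auto simp: disjoint_family_on_def split: bool.splits)
  then have "prob (\<Inter>j\<in>UNIV. case_bool A B j) = (\<Prod>j\<in>UNIV. prob (case_bool A B j))"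
    by (rule indep_setsD) (use assms in \<open>auto split: bool.splits\<close>)
  then show ?thesis by (simp add: UNIV_bool Int_commute mult.commute)
qed

text \<open>The indices are \<open>Inl h\<close> for \<open>Z h\<close>, \<open>Inr (Inl h)\<close>
  for \<open>W h\<close> and \<open>Inr (Inr u)\<close> for \<open>X u\<close>; an edge brings both
  its presence and its weight.\<close>

definition edge_index :: "nat set set \<Rightarrow> (nat set + nat set + nat) set" where
  "edge_index H = Inl ` H \<union> (Inr \<circ> Inl) ` H"

definition mark_index :: "nat set \<Rightarrow> (nat set + nat set + nat) set" where
  "mark_index U = (Inr \<circ> Inr) ` U"

lemma edge_index_subset: "H \<subseteq> complete_edges n \<Longrightarrow> edge_index H \<subseteq> var_index"
  by (auto simp: edge_index_def)

lemma mark_index_subset: "U \<subseteq> {1..n} \<Longrightarrow> mark_index U \<subseteq> var_index"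
  by (auto simp: mark_index_def)

lemma edge_index_disjoint: "H \<inter> H' = {} \<Longrightarrow> edge_index H \<inter> edge_index H' = {}"
  by (auto simp: edge_index_def)

lemma mark_index_disjoint: "U \<inter> U' = {} \<Longrightarrow> mark_index U \<inter> mark_index U' = {}"
  by (auto simp: mark_index_def)

lemma edge_mark_disjoint: "edge_index H \<inter> mark_index U = {}"
  by (auto simp: edge_index_def mark_index_def)

lemma Z_group_measurable:
  assumes "Inl h \<in> K"
  shows "Z h \<in> measurable (group_sigma K) (count_space UNIV)"
proof (rule measurableI)
  fix A :: "nat set"
  have "Z h -` A \<inter> space M \<in> var_sets (Inl h)" by (auto simp: var_sets_def)
  then show "Z h -` A \<inter> space (group_sigma K) \<in> sets (group_sigma K)"
    unfolding sets_group_sigma space_group_sigma using assms by (intro sigma_sets.Basic) blast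
qed simp

lemma W_group_measurable:
  assumes "Inr (Inl h) \<in> K"
  shows "W h \<in> borel_measurable (group_sigma K)"
proof (rule measurableI)
  fix A :: "real set" assume "A \<in> sets borel"
  then have "W h -` A \<inter> space M \<in> var_sets (Inr (Inl h))" by (auto simp: var_sets_def)
  then show "W h -` A \<inter> space (group_sigma K) \<in> sets (group_sigma K)"
    unfolding sets_group_sigma space_group_sigma using assms by (intro sigma_sets.Basic) blast
qed simp

lemma X_group_measurable:
  assumes "Inr (Inr u) \<in> K" "u \<in> {1..n}"
  shows "X u \<in> measurable (group_sigma K) MK"
proof (rule measurableI)
  fix A assume "A \<in> sets MK"
  then have "X u -` A \<inter> space M \<in> var_sets (Inr (Inr u))" by (auto simp: var_sets_def)
  then show "X u -` A \<inter> space (group_sigma K) \<in> sets (group_sigma K)"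
    unfolding sets_group_sigma space_group_sigma using assms by (intro sigma_sets.Basic) blast
qed (use measurable_space[OF X_measurable] assms in simp)

text \<open>Events tied to different edges are independent, so the probability that none occurs is a
  product. It serves both the absence of edges across a cut and the absence of good edges at a
  vertex.\<close>

lemma prob_no_edge_event_le:
  assumes "finite H" "H \<subseteq> complete_edges n" "\<And>h. h \<in> H \<Longrightarrow> G h \<in> sets (group_sigma (edge_index {h}))"
  shows "prob {\<omega> \<in> space M. \<forall>h\<in>H. \<omega> \<notin> G h} \<le> exp (- (\<Sum>h\<in>H. prob (G h)))"
\<comment> \<open>The empty case is separate because an empty intersection would be
  \<open>UNIV\<close> instead of \<open>space M\<close>.\<close>
proof (cases "H = {}")
  case False
  have "indep_sets (\<lambda>h. sets (group_sigma (edge_index {h}))) H"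
  proof (rule indep_groups)
    show "disjoint_family_on (\<lambda>h. edge_index {h}) H"
      unfolding disjoint_family_on_def by (simp add: edge_index_disjoint)
    show "edge_index {h} \<subseteq> var_index" if "h \<in> H" for h
      using that assms(2) by (intro edge_index_subset) blast
  qed
  then have "prob (\<Inter>h\<in>H. space M - G h) = (\<Prod>h\<in>H. prob (space M - G h))"
  proof (rule indep_setsD)
    show "\<forall>h\<in>H. space M - G h \<in> sets (group_sigma (edge_index {h}))"
    proof
      fix h assume "h \<in> H"
      from sets.compl_sets[OF assms(3)[OF this]] show "space M - G h \<in> sets (group_sigma (edge_index {h}))"
        by (simp only: space_group_sigma)
    qed
  qed (use False assms(1) in simp_all)
  also have "\<dots> = (\<Prod>h\<in>H. 1 - prob (G h))"
  proof (intro prod.cong refl prob_compl)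
    fix h assume "h \<in> H"
    then show "G h \<in> events" using assms(2,3) group_sigma_events[OF edge_index_subset[of "{h}"]] by blast
  qed
  also have "\<dots> \<le> exp (- (\<Sum>h\<in>H. prob (G h)))" by (rule prod_one_minus_le_exp) simp
  also have "(\<Inter>h\<in>H. space M - G h) = {\<omega> \<in> space M. \<forall>h\<in>H. \<omega> \<notin> G h}" using False by auto
  finally show ?thesis .
qed simp

section \<open>Connectedness and good edges\<close>

lemma Z_event: "{\<omega> \<in> space M. Z h \<omega> = 1} \<in> sets (group_sigma (edge_index {h}))"
proof -
  have [measurable]: "Z h \<in> measurable (group_sigma (edge_index {h})) (count_space UNIV)"
    by (rule Z_group_measurable) (simp add: edge_index_def)
  have "{\<omega> \<in> space (group_sigma (edge_index {h})). Z h \<omega> = 1} \<in> sets (group_sigma (edge_index {h}))"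
    by measurable
  then show ?thesis by simp
qed

text \<open>A measurable superset \<open>N\<close> spares the proof that the event itself is measurable.\<close>

lemma prob_disconnected_le:
  assumes s: "\<And>u S. u \<in> {1..n} \<Longrightarrow> S \<subseteq> {1..n} \<Longrightarrow> real n / 2 \<le> real (card S) \<Longrightarrow>
      s \<le> (\<Sum>v\<in>S - {u}. pe {u, v})"
  shows "\<exists>N\<in>events. {\<omega> \<in> space M. \<not> connected_graph {1..n} (present_edges n Z \<omega>)} \<subseteq> N \<and>
    prob N \<le> (1 + exp (- s)) ^ n - 1"
proof -
  define cut where "cut S = (\<lambda>(u, v). {u, v}) ` (S \<times> ({1..n} - S))" for S
  define G where "G h = {\<omega> \<in> space M. Z h \<omega> = 1}" for h
  define Q where "Q S = {\<omega> \<in> space M. \<forall>h\<in>cut S. \<omega> \<notin> G h}" for S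
  let ?P = "{S. S \<subseteq> {1..n} \<and> S \<noteq> {} \<and> 2 * card S \<le> n}"
  have fin: "finite ?P" by simp
  have cut: "cut S \<subseteq> complete_edges n" if "S \<subseteq> {1..n}" for S
    using that by (auto simp: cut_def intro!: edge_in_complete)
  have cut_fin: "finite (cut S)" if "S \<subseteq> {1..n}" for S
    using cut[OF that] finite_complete_edges finite_subset by blast
  have G: "G h \<in> sets (group_sigma (edge_index {h}))" for h unfolding G_def by (rule Z_event)
  have G_ev: "G h \<in> events" if "h \<in> complete_edges n" for h
    using G group_sigma_events[OF edge_index_subset, of "{h}"] that by blast
  have Q_ev: "Q S \<in> events" if "S \<subseteq> {1..n}" for S
  proof -
    have "Q S = space M - (\<Union>h\<in>cut S. G h)" by (auto simp: Q_def)
    moreover have "(\<Union>h\<in>cut S. G h) \<in> events"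
      using cut[OF that] cut_fin[OF that] G_ev by (intro sets.finite_UN) blast+
    ultimately show ?thesis by (simp add: sets.compl_sets)
  qed
  have Q_le: "prob (Q S) \<le> exp (- s) ^ card S" if S: "S \<in> ?P" for S
  proof -
    have S': "S \<subseteq> {1..n}" "finite S" using S finite_subset[of S "{1..n}"] by auto
    have "prob (Q S) \<le> exp (- (\<Sum>h\<in>cut S. prob (G h)))"
      unfolding Q_def using cut[OF S'(1)] cut_fin[OF S'(1)] G by (intro prob_no_edge_event_le)
    also have "(\<Sum>h\<in>cut S. prob (G h)) = (\<Sum>h\<in>cut S. pe h)"
      unfolding G_def using cut[OF S'(1)] by (intro sum.cong refl Z_one) blast
    also have "\<dots> = (\<Sum>(u, v)\<in>S \<times> ({1..n} - S). pe {u, v})"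
      unfolding cut_def by (subst sum.reindex[OF inj_on_doubleton]) (auto simp: case_prod_beta)
    also have "\<dots> = (\<Sum>u\<in>S. \<Sum>v\<in>{1..n} - S. pe {u, v})" by (simp add: sum.cartesian_product)
    finally have 1: "prob (Q S) \<le> exp (- (\<Sum>u\<in>S. \<Sum>v\<in>{1..n} - S. pe {u, v}))" .
    \<comment> \<open>The complement of \<open>S\<close> has at least \<open>n / 2\<close> vertices,
      so each vertex of \<open>S\<close> contributes at least \<open>s\<close> to the edge sum
      across the cut.\<close>
    have "(\<Sum>u\<in>S. s) \<le> (\<Sum>u\<in>S. \<Sum>v\<in>{1..n} - S. pe {u, v})"
    proof (rule sum_mono)
      fix u assume u: "u \<in> S"
      have "card ({1..n} - S) = n - card S" using S' by (simp add: card_Diff_subset)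
      then have "real n / 2 \<le> real (card ({1..n} - S))" using S by (auto simp: of_nat_diff)
      then have "s \<le> (\<Sum>v\<in>({1..n} - S) - {u}. pe {u, v})" using u S' by (intro s) auto
      also have "({1..n} - S) - {u} = {1..n} - S" using u by auto
      finally show "s \<le> (\<Sum>v\<in>{1..n} - S. pe {u, v})" .
    qed
    then have "exp (- (\<Sum>u\<in>S. \<Sum>v\<in>{1..n} - S. pe {u, v})) \<le> exp (- (real (card S) * s))" by simp
    also have "\<dots> = exp (- s) ^ card S" by (simp add: exp_of_nat_mult[symmetric])
    finally show ?thesis using 1 by linarith
  qed
  have sub: "{\<omega> \<in> space M. \<not> connected_graph {1..n} (present_edges n Z \<omega>)} \<subseteq> (\<Union>S\<in>?P. Q S)"
  proof clarify
    fix \<omega> assume w: "\<omega> \<in> space M" and d: "\<not> connected_graph {1..n} (present_edges n Z \<omega>)"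
    obtain S where S: "S \<subseteq> {1..n}" "S \<noteq> {}" "2 * card S \<le> card {1..n}"
        "\<And>u v. u \<in> S \<Longrightarrow> v \<in> {1..n} - S \<Longrightarrow> {u, v} \<notin> present_edges n Z \<omega>"
      using disconnected_cut[OF _ d] by auto
    have "\<omega> \<notin> G h" if h: "h \<in> cut S" for h
    proof -
      obtain u v where "h = {u, v}" "u \<in> S" "v \<in> {1..n} - S" using h by (auto simp: cut_def)
      then have "h \<notin> present_edges n Z \<omega>" using S(4) by blast
      moreover have "h \<in> complete_edges n" using cut[OF S(1)] h by blast
      ultimately show ?thesis by (simp add: present_edges_def G_def)
    qed
    then have "\<omega> \<in> Q S" using w by (simp add: Q_def)
    moreover have "S \<in> ?P" using S(1-3) by simp
    ultimately show "\<omega> \<in> (\<Union>S\<in>?P. Q S)" by (rule UN_I[rotated])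
  qed
  have ev: "(\<Union>S\<in>?P. Q S) \<in> events"
    using fin Q_ev by (intro sets.finite_UN) auto
  have "prob (\<Union>S\<in>?P. Q S) \<le> (\<Sum>S\<in>?P. prob (Q S))"
    using fin Q_ev by (intro finite_measure_subadditive_finite) auto
  also have "\<dots> \<le> (\<Sum>S\<in>?P. exp (- s) ^ card S)" by (intro sum_mono Q_le)
  \<comment> \<open>Dropping the size restriction leaves all nonempty subsets; the missing term of
    the empty set is the \<open>1\<close> subtracted in the bound.\<close>
  also have "\<dots> \<le> (\<Sum>S\<in>Pow {1..n} - {{}}. exp (- s) ^ card S)"
    by (intro sum_mono2) auto
  also have "\<dots> = (1 + exp (- s)) ^ n - 1"
    by (simp add: sum_diff1 sum_power_card_Pow)
  finally show ?thesis using sub ev by blast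
qed

text \<open>The cost factor is left to \<open>good_pair\<close>, so this event depends on the edge
  variables alone and is independent of the marks.\<close>

definition good_edge :: "real \<Rightarrow> nat set \<Rightarrow> 'w set" where
  "good_edge w h = {\<omega> \<in> space M. Z h \<omega> = 1 \<and> w < W h \<omega>}"

lemma good_edge_group:
  assumes "h \<in> H"
  shows "good_edge w h \<in> sets (group_sigma (edge_index H))"
proof -
  have [measurable]: "Z h \<in> measurable (group_sigma (edge_index H)) (count_space UNIV)"
    "W h \<in> borel_measurable (group_sigma (edge_index H))"
    using assms by (auto intro!: Z_group_measurable W_group_measurable simp: edge_index_def)
  have "{\<omega> \<in> space (group_sigma (edge_index H)). Z h \<omega> = 1 \<and> w < W h \<omega>} \<in> sets (group_sigma (edge_index H))"
    by measurable
  then show ?thesis by (simp add: good_edge_def)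
qed

lemma prob_good_edge:
  assumes h: "h \<in> complete_edges n"
  shows "prob (good_edge w h) = pe h * ccdf \<mu> w"
proof -
  \<comment> \<open>Presence and weight of the same edge are put into different groups to use their
    independence.\<close>
  let ?K = "{Inl h}" and ?L = "{Inr (Inl h)}"
  have [measurable]: "Z h \<in> measurable (group_sigma ?K) (count_space UNIV)"
    "W h \<in> borel_measurable (group_sigma ?L)"
    by (auto intro!: Z_group_measurable W_group_measurable)
  have "{\<omega> \<in> space (group_sigma ?K). Z h \<omega> = 1} \<in> sets (group_sigma ?K)" by measurable
  moreover have "{\<omega> \<in> space (group_sigma ?L). w < W h \<omega>} \<in> sets (group_sigma ?L)" by measurable
  ultimately have "prob ({\<omega> \<in> space M. Z h \<omega> = 1} \<inter> {\<omega> \<in> space M. w < W h \<omega>}) =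
      prob {\<omega> \<in> space M. Z h \<omega> = 1} * prob {\<omega> \<in> space M. w < W h \<omega>}"
    using h by (intro prob_Int_groups[of ?K ?L]) auto
  moreover have "prob {\<omega> \<in> space M. w < W h \<omega>} = ccdf \<mu> w"
    unfolding ccdf_def W_law[OF h, symmetric] using W_measurable[OF h]
    by (subst measure_distr) (auto intro!: arg_cong[where f = prob])
  moreover have "good_edge w h = {\<omega> \<in> space M. Z h \<omega> = 1} \<inter> {\<omega> \<in> space M. w < W h \<omega>}"
    by (auto simp: good_edge_def)
  ultimately show ?thesis using Z_one[OF h] by simp
qed

section \<open>Tail bounds for good pairs and good edges\<close>

definition good_pair :: "real \<Rightarrow> nat \<Rightarrow> nat \<Rightarrow> 'w set" where
  "good_pair d u v = {\<omega> \<in> space M. d \<le> r (X u \<omega>) (X v \<omega>)}"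

lemma good_pair_group:
  assumes "u \<in> U" "v \<in> U" "U \<subseteq> {1..n}"
  shows "good_pair d u v \<in> sets (group_sigma (mark_index U))"
proof -
  have [measurable]: "X u \<in> measurable (group_sigma (mark_index U)) MK"
    "X v \<in> measurable (group_sigma (mark_index U)) MK"
    using assms by (auto intro!: X_group_measurable simp: mark_index_def)
  note r_measurable [measurable]
  have "{\<omega> \<in> space (group_sigma (mark_index U)). d \<le> case_prod r (X u \<omega>, X v \<omega>)} \<in> sets (group_sigma (mark_index U))"
    by measurable
  then show ?thesis by (simp add: good_pair_def)
qed

lemma mark_pair_law:
  assumes "u \<in> {1..n}" "v \<in> {1..n}" "u \<noteq> v"
  shows "distr M (MK \<Otimes>\<^sub>M MK) (\<lambda>\<omega>. (X u \<omega>, X v \<omega>)) = distr M MK (X u) \<Otimes>\<^sub>M distr M MK (X v)"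
proof -
  have sets: "sigma_sets (space M) {X w -` A \<inter> space M | A. A \<in> sets MK} = sets (group_sigma (mark_index {w}))" for w
    by (simp add: sets_group_sigma mark_index_def var_sets_def)
  have "indep_set (sets (group_sigma (mark_index {u}))) (sets (group_sigma (mark_index {v})))"
  proof (rule indep_setI)
    show "prob (A \<inter> B) = prob A * prob B"
      if "A \<in> sets (group_sigma (mark_index {u}))" "B \<in> sets (group_sigma (mark_index {v}))" for A B
      using assms that by (intro prob_Int_groups[of "mark_index {u}" "mark_index {v}"] mark_index_disjoint mark_index_subset) auto
  qed (use assms in \<open>intro group_sigma_events mark_index_subset; simp\<close>)+
  then have "indep_var MK (X u) MK (X v)"
    unfolding indep_var_eq sets using X_measurable assms by blast
  then show ?thesis by (simp add: indep_var_distribution_eq)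
qed

text \<open>For distinct vertices the joint law of the two marks is the product of the common
  marginal with itself, so what the moments of \<open>r (X 1) (X 2)\<close> imply reaches every
  pair.\<close>

lemma prob_good_pair:
  assumes "u \<in> {1..n}" "v \<in> {1..n}" "u \<noteq> v" "u' \<in> {1..n}" "v' \<in> {1..n}" "u' \<noteq> v'"
  shows "prob (good_pair d u v) = prob (good_pair d u' v')"
proof -
  note r_measurable [measurable]
  have *: "prob (good_pair d u v) = measure (distr M (MK \<Otimes>\<^sub>M MK) (\<lambda>\<omega>. (X u \<omega>, X v \<omega>)))
      {z \<in> space (MK \<Otimes>\<^sub>M MK). d \<le> case_prod r z}" if "u \<in> {1..n}" "v \<in> {1..n}" for u v
  proof -
    have [measurable]: "X u \<in> measurable M MK" "X v \<in> measurable M MK" using X_measurable that by auto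
    have "(\<lambda>\<omega>. (X u \<omega>, X v \<omega>)) -` {z \<in> space (MK \<Otimes>\<^sub>M MK). d \<le> case_prod r z} \<inter> space M = good_pair d u v"
      using measurable_space[OF X_measurable] that by (auto simp: good_pair_def space_pair_measure)
    then show ?thesis by (subst measure_distr) (simp_all, measurable)
  qed
  show ?thesis
    unfolding *[OF assms(1,2)] *[OF assms(4,5)] mark_pair_law[OF assms(1-3)] mark_pair_law[OF assms(4-6)]
    using X_identical[OF assms(1,4)] X_identical[OF assms(2,5)] by simp
qed

text \<open>The expected weight of the good pairs is at least \<open>q * \<alpha> * card A\<close>.
  Two pairs can be dependent only if they share a vertex, and those sharing one with a given pair
  form a row and a column of weight at most \<open>\<beta>\<close> each.\<close>

lemma good_pairs_lower_tail:
  assumes AB: "A \<subseteq> {1..n}" "B \<subseteq> {1..n}" "A \<inter> B = {}" "A \<noteq> {}"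
    and q: "0 < q" "\<And>u v. u \<in> A \<Longrightarrow> v \<in> B \<Longrightarrow> q \<le> prob (good_pair d u v)"
    and low: "0 < \<alpha>" "\<And>u. u \<in> A \<Longrightarrow> \<alpha> \<le> (\<Sum>v\<in>B. pe {u, v})"
    and up: "\<And>u. u \<in> {1..n} \<Longrightarrow> (\<Sum>v\<in>{1..n} - {u}. pe {u, v}) \<le> \<beta>"
  shows "prob {\<omega> \<in> space M. (\<Sum>(u, v)\<in>A \<times> B. pe {u, v} * indicator (good_pair d u v) \<omega>) \<le> q * \<alpha> * card A / 2}
     \<le> 8 * \<beta>\<^sup>2 / (q\<^sup>2 * \<alpha>\<^sup>2 * card A)"
proof -
  have fin: "finite A" "finite B" using AB(1,2) by (auto intro: finite_subset)
  have cA: "0 < real (card A)" using AB fin by (simp add: card_gt_0_iff)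
  define c where "c = (\<lambda>(u, v). pe {u, v})"
  define G where "G = (\<lambda>(u, v). good_pair d u v)"
  \<comment> \<open>\<open>A\<close> and \<open>B\<close> are disjoint, so a common vertex sits at
    the same position in both pairs.\<close>
  define D :: "((nat \<times> nat) \<times> (nat \<times> nat)) set" where "D = {(i, j). fst i = fst j \<or> snd i = snd j}"
  define m where "m = q * \<alpha> * card A"
  have m0: "0 < m" using q low cA by (simp add: m_def)
  have pe0: "0 \<le> pe {u, v}" if "u \<in> {1..n}" "v \<in> {1..n}" "u \<noteq> v" for u v
    using edge_prob[OF edge_in_complete[OF that]] by simp
  have c0: "0 \<le> c i" if i: "i \<in> A \<times> B" for i
  proof -
    obtain u v where uv: "i = (u, v)" "u \<in> A" "v \<in> B" using i by auto
    then have "u \<in> {1..n}" "v \<in> {1..n}" "u \<noteq> v" using AB by blast+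
    then show ?thesis using pe0 uv(1) by (simp add: c_def)
  qed
  have rowle: "(\<Sum>v\<in>S. pe {u, v}) \<le> \<beta>" if "u \<in> {1..n}" "S \<subseteq> {1..n}" "u \<notin> S" for u S
    by (rule order_trans[OF _ up[OF that(1)]], rule sum_mono2) (use that pe0 in auto)
  have disj: "u \<noteq> v" if "u \<in> A" "v \<in> B" for u v using that AB by blast
  \<comment> \<open>This makes \<open>\<beta>\<close> positive, for the monotonicity in the last
    variance estimate.\<close>
  have \<beta>: "\<alpha> \<le> \<beta>"
  proof -
    obtain u where "u \<in> A" using AB by blast
    then show ?thesis using low(2)[of u] rowle[of u B] AB by fastforce
  qed
  have "prob {\<omega> \<in> space M. (\<Sum>i\<in>A \<times> B. c i * indicator (G i) \<omega>) \<le> m / 2} \<le> 4 * (2 * \<beta>\<^sup>2 * card A) / m\<^sup>2"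
  proof (rule weighted_indicator_lower_tail[where D = D])
    show "finite (A \<times> B)" using fin by simp
    show "G i \<in> events" if "i \<in> A \<times> B" for i
    proof -
      have "G i \<in> sets (group_sigma (mark_index {1..n}))"
        using that AB(1,2) unfolding G_def case_prod_beta by (intro good_pair_group) auto
      moreover have "sets (group_sigma (mark_index {1..n})) \<subseteq> events"
        by (intro group_sigma_events mark_index_subset) simp
      ultimately show ?thesis by (rule subsetD[rotated])
    qed
    show "prob (G i \<inter> G j) = prob (G i) * prob (G j)"
      if ij: "i \<in> A \<times> B" "j \<in> A \<times> B" "(i, j) \<notin> D" for i j
    proof (rule prob_Int_groups)
      obtain u v u' v' where [simp]: "i = (u, v)" "j = (u', v')" by (cases i, cases j) auto
      show "mark_index {fst i, snd i} \<inter> mark_index {fst j, snd j} = {}"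
        using ij AB(3) by (intro mark_index_disjoint) (auto simp: D_def)
      show "mark_index {fst i, snd i} \<subseteq> var_index" "mark_index {fst j, snd j} \<subseteq> var_index"
        using ij AB(1,2) by (intro mark_index_subset; auto)+
      show "G i \<in> sets (group_sigma (mark_index {fst i, snd i}))" "G j \<in> sets (group_sigma (mark_index {fst j, snd j}))"
        using ij AB(1,2) by (auto simp: G_def intro!: good_pair_group)
    qed
    have "m = (\<Sum>u\<in>A. q * \<alpha>)" by (simp add: m_def)
    also have "\<dots> \<le> (\<Sum>u\<in>A. q * (\<Sum>v\<in>B. pe {u, v}))"
      using q(1) low(2) by (intro sum_mono mult_left_mono) auto
    also have "\<dots> = (\<Sum>i\<in>A \<times> B. c i * q)"
      by (simp add: sum_distrib_left sum.cartesian_product c_def case_prod_beta mult.commute)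
    also have "\<dots> \<le> (\<Sum>i\<in>A \<times> B. c i * prob (G i))"
      using q(2) c0 by (intro sum_mono mult_left_mono) (auto simp: G_def)
    finally show "m \<le> (\<Sum>i\<in>A \<times> B. c i * prob (G i))" .
    have "(\<Sum>(i, j)\<in>((A \<times> B) \<times> (A \<times> B)) \<inter> D. c i * c j)
      = (\<Sum>i\<in>A \<times> B. \<Sum>j\<in>A \<times> B. if (i, j) \<in> D then c i * c j else 0)"
      using fin by (simp add: sum.cartesian_product sum.inter_restrict case_prod_beta)
    also have "\<dots> \<le> (\<Sum>i\<in>A \<times> B. c i * (2 * \<beta>))"
    proof (rule sum_mono)
      fix i assume i: "i \<in> A \<times> B"
      obtain u v where uv: "i = (u, v)" "u \<in> A" "v \<in> B" using i by auto
      have "(\<Sum>j\<in>A \<times> B. if (i, j) \<in> D then c i * c j else 0)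
          = c i * (\<Sum>j\<in>(A \<times> B) \<inter> {j. (i, j) \<in> D}. c j)"
        using fin by (simp add: sum.inter_restrict sum_distrib_left if_distrib cong: if_cong)
      \<comment> \<open>The pairs related to \<open>(u, v)\<close> by \<open>D\<close> form the row
        of \<open>u\<close> and the column of \<open>v\<close>.\<close>
      also have "(\<Sum>j\<in>(A \<times> B) \<inter> {j. (i, j) \<in> D}. c j) \<le> (\<Sum>j\<in>{u} \<times> B \<union> A \<times> {v}. c j)"
        using fin c0 uv by (intro sum_mono2) (auto simp: D_def)
      also have "\<dots> \<le> (\<Sum>j\<in>{u} \<times> B. c j) + (\<Sum>j\<in>A \<times> {v}. c j)"
      proof -
        have "0 \<le> (\<Sum>j\<in>{u} \<times> B \<inter> A \<times> {v}. c j)" using c0 uv by (intro sum_nonneg) auto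
        then show ?thesis using sum.union_inter[of "{u} \<times> B" "A \<times> {v}" c] fin by auto
      qed
      also have "(\<Sum>j\<in>{u} \<times> B. c j) = (\<Sum>v\<in>B. pe {u, v})"
        by (simp add: c_def sum.cartesian_product[symmetric])
      also have "\<dots> \<le> \<beta>" using uv AB by (intro rowle) auto
      also have "(\<Sum>j\<in>A \<times> {v}. c j) = (\<Sum>u\<in>A. pe {v, u})"
        by (simp add: c_def sum.cartesian_product[symmetric] insert_commute)
      also have "\<dots> \<le> \<beta>" using uv AB by (intro rowle) auto
      finally show "(\<Sum>j\<in>A \<times> B. if (i, j) \<in> D then c i * c j else 0) \<le> c i * (2 * \<beta>)"
        using c0[OF i] by (simp add: mult_left_mono)
    qed
    also have "\<dots> = 2 * \<beta> * (\<Sum>u\<in>A. \<Sum>v\<in>B. pe {u, v})"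
      by (simp add: sum_distrib_left sum.cartesian_product c_def case_prod_beta mult_ac)
    also have "\<dots> \<le> 2 * \<beta> * (\<Sum>u\<in>A. \<beta>)"
      using \<beta> low(1) AB by (intro mult_left_mono sum_mono rowle) auto
    also have "\<dots> = 2 * \<beta>\<^sup>2 * card A" by (simp add: power2_eq_square)
    finally show "(\<Sum>(i, j)\<in>((A \<times> B) \<times> (A \<times> B)) \<inter> D. c i * c j) \<le> 2 * \<beta>\<^sup>2 * card A" .
  qed (use c0 m0 in auto)
  moreover have "4 * (2 * \<beta>\<^sup>2 * card A) / m\<^sup>2 = 8 * \<beta>\<^sup>2 / (q\<^sup>2 * \<alpha>\<^sup>2 * card A)"
    using cA q(1) low(1) by (simp add: m_def power2_eq_square field_simps)
  ultimately show ?thesis by (simp add: c_def G_def m_def case_prod_beta)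
qed

text \<open>With \<open>g\<close> as a fixed parameter the event depends on edge variables only; the
  random set of good pairs is put in for \<open>g\<close> later.\<close>

definition hit :: "real \<Rightarrow> (nat \<times> nat) set \<Rightarrow> nat \<Rightarrow> 'w set" where
  "hit w g u = {\<omega> \<in> space M. \<exists>v. (u, v) \<in> g \<and> \<omega> \<in> good_edge w {u, v}}"

lemma hit_group:
  assumes "finite g" "\<And>v. (u, v) \<in> g \<Longrightarrow> {u, v} \<in> H"
  shows "hit w g u \<in> sets (group_sigma (edge_index H))"
proof -
  have "hit w g u = (\<Union>v\<in>g `` {u}. good_edge w {u, v})"
    by (auto simp: hit_def good_edge_def)
  also have "\<dots> \<in> sets (group_sigma (edge_index H))"
    using assms by (intro sets.finite_UN good_edge_group) auto
  finally show ?thesis .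
qed

text \<open>Let \<open>s\<close> be the total edge probability at \<open>u\<close> within
  \<open>g\<close>. Each good edge \<open>h\<close> has probability at least
  \<open>pe h / y\<close>, so \<open>u\<close> is missed with probability at most
  \<open>exp (- (s / y))\<close>, and \<open>s / y \<le> b\<close> allows the linear bound.\<close>

lemma prob_hit_ge:
  assumes AB: "A \<subseteq> {1..n}" "B \<subseteq> {1..n}" "A \<inter> B = {}" "g \<subseteq> A \<times> B" "u \<in> A"
    and y: "0 < y" "1 / y \<le> ccdf \<mu> w" and b: "(\<Sum>v\<in>B. pe {u, v}) \<le> b * y"
  shows "(\<Sum>v\<in>g `` {u}. pe {u, v}) / y / (1 + b) \<le> prob (hit w g u)"
proof -
  have fin: "finite g" using AB finite_subset[OF AB(4)] finite_subset[of A "{1..n}"] finite_subset[of B "{1..n}"] by auto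
  define H where "H = (\<lambda>v. {u, v}) ` (g `` {u})"
  have H: "finite H" "H \<subseteq> complete_edges n"
    using fin AB by (auto simp: H_def intro!: edge_in_complete)
  have inj: "inj_on (\<lambda>v. {u, v}) S" for S by (auto simp: inj_on_def doubleton_eq_iff)
  define s where "s = (\<Sum>v\<in>g `` {u}. pe {u, v})"
  have pe0: "0 \<le> pe {u, v}" if "v \<in> B" for v
    using edge_prob[OF edge_in_complete[of u n v]] that AB by fastforce
  have s0: "0 \<le> s" unfolding s_def using AB pe0 by (intro sum_nonneg) auto
  have "s \<le> (\<Sum>v\<in>B. pe {u, v})"
    unfolding s_def using AB pe0 finite_subset[of B "{1..n}"] by (intro sum_mono2) auto
  then have sb: "s / y \<le> b" using b y by (simp add: divide_le_eq)
  have hit_ev: "hit w g u \<in> events"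
    using hit_group[of g u H] fin group_sigma_events[OF edge_index_subset[OF H(2)]] by (auto simp: H_def)
  have "{\<omega> \<in> space M. \<forall>h\<in>H. \<omega> \<notin> good_edge w h} = space M - hit w g u"
    by (auto simp: H_def hit_def)
  then have "1 - prob (hit w g u) = prob {\<omega> \<in> space M. \<forall>h\<in>H. \<omega> \<notin> good_edge w h}"
    using prob_compl[OF hit_ev] by simp
  also have "\<dots> \<le> exp (- (\<Sum>h\<in>H. prob (good_edge w h)))"
    using H by (intro prob_no_edge_event_le good_edge_group) auto
  also have "(\<Sum>h\<in>H. prob (good_edge w h)) = (\<Sum>h\<in>H. pe h * ccdf \<mu> w)"
    using H(2) by (intro sum.cong refl prob_good_edge) blast
  also have "\<dots> = s * ccdf \<mu> w"
    unfolding H_def s_def by (subst sum.reindex[OF inj]) (simp add: sum_distrib_right)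
  finally have "1 - exp (- (s * ccdf \<mu> w)) \<le> prob (hit w g u)" by linarith
  moreover have "s / y \<le> s * ccdf \<mu> w" using mult_left_mono[OF y(2) s0] by simp
  moreover have "s / y / (1 + b) \<le> 1 - exp (- (s / y))"
    using s0 y sb by (intro one_minus_exp_ge) auto
  ultimately show ?thesis unfolding s_def[symmetric] by (smt (verit) exp_le_cancel_iff)
qed

text \<open>Edges from different vertices of \<open>A\<close> into \<open>B\<close> are different,
  so the hits are independent; with \<open>D = Id\<close> the variance is at most
  \<open>card A\<close>.\<close>

lemma hits_lower_tail:
  assumes AB: "A \<subseteq> {1..n}" "B \<subseteq> {1..n}" "A \<inter> B = {}" "g \<subseteq> A \<times> B"
    and y: "0 < y" "1 / y \<le> ccdf \<mu> w" and b: "\<And>u. u \<in> A \<Longrightarrow> (\<Sum>v\<in>B. pe {u, v}) \<le> b * y"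
    and m: "0 < m" "m \<le> (\<Sum>(u, v)\<in>g. pe {u, v}) / y / (1 + b)"
  shows "prob {\<omega> \<in> space M. (\<Sum>u\<in>A. indicator (hit w g u) \<omega>) \<le> m / 2} \<le> 4 * card A / m\<^sup>2"
proof -
  have fin: "finite A" "finite B" using AB(1,2) by (auto intro: finite_subset)
  have fing: "finite g" using AB fin finite_subset by fast
  have H: "{{u, v} | v. v \<in> B} \<subseteq> complete_edges n" if "u \<in> A" for u
    using AB that by (auto intro!: edge_in_complete)
  have hit: "hit w g u \<in> sets (group_sigma (edge_index {{u, v} | v. v \<in> B}))" if "u \<in> A" for u
    using that AB fing by (intro hit_group) auto
  have "prob {\<omega> \<in> space M. (\<Sum>u\<in>A. 1 * indicator (hit w g u) \<omega>) \<le> m / 2} \<le> 4 * real (card A) / m\<^sup>2"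
  proof (rule weighted_indicator_lower_tail[where D = Id])
    show "hit w g u \<in> events" if "u \<in> A" for u
      using hit[OF that] group_sigma_events[OF edge_index_subset[OF H[OF that]]] by blast
    show "prob (hit w g u \<inter> hit w g u') = prob (hit w g u) * prob (hit w g u')"
      if "u \<in> A" "u' \<in> A" "(u, u') \<notin> Id" for u u'
      using that H hit AB
      by (intro prob_Int_groups[OF edge_index_disjoint[of "{{u, v} | v. v \<in> B}" "{{u', v} | v. v \<in> B}"]] edge_index_subset)
        (auto simp: doubleton_eq_iff)
    have "(\<Sum>(u, v)\<in>g. pe {u, v}) = (\<Sum>u\<in>A. \<Sum>v\<in>g `` {u}. pe {u, v})"
    proof -
      have "g = Sigma A (\<lambda>u. g `` {u})" using AB(4) by auto
      then have "(\<Sum>(u, v)\<in>g. pe {u, v}) = (\<Sum>(u, v)\<in>Sigma A (\<lambda>u. g `` {u}). pe {u, v})" by simp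
      also have "\<dots> = (\<Sum>u\<in>A. \<Sum>v\<in>g `` {u}. pe {u, v})"
        using fin fing by (subst sum.Sigma) auto
      finally show ?thesis .
    qed
    then have "m \<le> (\<Sum>u\<in>A. (\<Sum>v\<in>g `` {u}. pe {u, v}) / y / (1 + b))"
      using m by (simp add: sum_divide_distrib)
    also have "\<dots> \<le> (\<Sum>u\<in>A. 1 * prob (hit w g u))"
      unfolding mult_1 using AB y b by (intro sum_mono prob_hit_ge) auto
    finally show "m \<le> (\<Sum>u\<in>A. 1 * prob (hit w g u))" .
    have "(A \<times> A) \<inter> Id = (\<lambda>u. (u, u)) ` A" by auto
    then show "(\<Sum>(u, u')\<in>(A \<times> A) \<inter> Id. 1 * 1) \<le> real (card A)"
      using fin by (simp add: card_image inj_on_def)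
  qed (use fin m in auto)
  then show ?thesis by simp
qed

definition good_pairs :: "nat set \<Rightarrow> nat set \<Rightarrow> real \<Rightarrow> 'w \<Rightarrow> (nat \<times> nat) set" where
  "good_pairs A B d \<omega> = {(u, v) \<in> A \<times> B. \<omega> \<in> good_pair d u v}"

lemma good_pairs_event:
  assumes "A \<subseteq> {1..n}" "B \<subseteq> {1..n}"
  shows "{\<omega> \<in> space M. good_pairs A B d \<omega> = g} \<in> sets (group_sigma (mark_index {1..n}))"
proof -
  let ?N = "group_sigma (mark_index {1..n})"
  have fin: "finite (A \<times> B)" using assms by (auto intro: finite_subset)
  have *: "{\<omega> \<in> space ?N. \<omega> \<in> good_pair d (fst i) (snd i) \<longleftrightarrow> i \<in> g} \<in> sets ?N" if "i \<in> A \<times> B" for i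
  proof -
    have [measurable]: "good_pair d (fst i) (snd i) \<in> sets ?N"
      using that assms by (intro good_pair_group) auto
    show ?thesis by measurable
  qed
  have "{\<omega> \<in> space ?N. \<forall>i\<in>A \<times> B. \<omega> \<in> good_pair d (fst i) (snd i) \<longleftrightarrow> i \<in> g} \<in> sets ?N"
    by (rule sets.sets_Collect_finite_All[OF * fin])
  \<comment> \<open>The value is always a subset of \<open>A \<times> B\<close>; any other
    \<open>g\<close> gives the empty event.\<close>
  moreover have "{\<omega> \<in> space M. good_pairs A B d \<omega> = g} =
    (if g \<subseteq> A \<times> B then {\<omega> \<in> space ?N. \<forall>i\<in>A \<times> B. \<omega> \<in> good_pair d (fst i) (snd i) \<longleftrightarrow> i \<in> g} else {})"
    by (auto simp: good_pairs_def)
  ultimately show ?thesis by simp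
qed

text \<open>Few hits arise in two ways: the good pairs carry little edge probability, or the marks
  produce some \<open>g\<close> of large weight for which the edges give few hits. For fixed
  \<open>g\<close> the conditions on marks and on edges are independent, so a sum over the finitely
  many \<open>g\<close> replaces conditioning.\<close>

lemma prob_hits_bad_le:
  assumes AB: "A \<subseteq> {1..n}" "B \<subseteq> {1..n}" "A \<inter> B = {}" "A \<noteq> {}"
    and q: "0 < q" "\<And>u v. u \<in> A \<Longrightarrow> v \<in> B \<Longrightarrow> q \<le> prob (good_pair d u v)"
    and ab: "0 < a" "0 < b" and y: "0 < y" "1 / y \<le> ccdf \<mu> w"
    and low: "\<And>u. u \<in> A \<Longrightarrow> a * y \<le> (\<Sum>v\<in>B. pe {u, v})"
    and up: "\<And>u. u \<in> {1..n} \<Longrightarrow> (\<Sum>v\<in>{1..n} - {u}. pe {u, v}) \<le> b * y"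
  shows "\<exists>N\<in>events.
     {\<omega> \<in> space M. (\<Sum>u\<in>A. indicator (hit w (good_pairs A B d \<omega>) u) \<omega>) \<le> q * a / (4 * (1 + b)) * card A} \<subseteq> N \<and>
     prob N \<le> (8 * b\<^sup>2 + 16 * (1 + b)\<^sup>2) / (q\<^sup>2 * a\<^sup>2) / card A"
proof -
  have fin: "finite A" "finite B" using AB by (auto intro: finite_subset)
  have cA: "0 < real (card A)" using AB fin by (simp add: card_gt_0_iff)
  define S where "S g = (\<Sum>(u, v)\<in>g. pe {u, v})" for g
  \<comment> \<open>A lower bound for the expected number of hits once \<open>S g\<close> exceeds
    half of \<open>q * (a * y) * card A\<close>; the threshold in the claim is
    \<open>m / 2\<close>.\<close>
  define m where "m = q * a * card A / (2 * (1 + b))"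
  have m0: "0 < m" using q ab cA by (simp add: m_def)
  define L where "L = {\<omega> \<in> space M. (\<Sum>(u, v)\<in>A \<times> B. pe {u, v} * indicator (good_pair d u v) \<omega>) \<le> q * (a * y) * card A / 2}"
  define P where "P g = {\<omega> \<in> space M. good_pairs A B d \<omega> = g}" for g
  define Q where "Q g = {\<omega> \<in> space M. (\<Sum>u\<in>A. indicator (hit w g u) \<omega>) \<le> m / 2}" for g
  define GG where "GG = {g. g \<subseteq> A \<times> B \<and> q * (a * y) * card A / 2 < S g}"
  define K where "K = 4 * card A / m\<^sup>2"
  have finGG: "finite GG" using fin by (simp add: GG_def)
  have mark_ev: "sets (group_sigma (mark_index {1..n})) \<subseteq> events"
    by (intro group_sigma_events mark_index_subset) simp
  have edge_ev: "sets (group_sigma (edge_index (complete_edges n))) \<subseteq> events"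
    by (intro group_sigma_events edge_index_subset) simp
  have P_grp: "P g \<in> sets (group_sigma (mark_index {1..n}))" for g
    unfolding P_def by (rule good_pairs_event[OF AB(1,2)])
  have Q_grp: "Q g \<in> sets (group_sigma (edge_index (complete_edges n)))" if "g \<subseteq> A \<times> B" for g
  proof -
    have "finite g" using that fin finite_subset by fast
    then have [measurable]: "hit w g u \<in> sets (group_sigma (edge_index (complete_edges n)))" for u
      using that AB by (intro hit_group) (auto intro!: edge_in_complete)
    have "{\<omega> \<in> space (group_sigma (edge_index (complete_edges n))). (\<Sum>u\<in>A. indicator (hit w g u) \<omega> :: real) \<le> m / 2}
      \<in> sets (group_sigma (edge_index (complete_edges n)))" by measurable
    then show ?thesis by (simp add: Q_def)
  qed
  have [measurable]: "good_pair d u v \<in> events" if "(u, v) \<in> A \<times> B" for u v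
    using that AB(1,2) good_pair_group[of u "{1..n}" v d] mark_ev by blast
  have L_ev: "L \<in> events"
  proof -
    have "(\<lambda>\<omega>. \<Sum>i\<in>A \<times> B. pe {fst i, snd i} * indicator (good_pair d (fst i) (snd i)) \<omega>) \<in> borel_measurable M"
      by (intro borel_measurable_sum borel_measurable_times borel_measurable_const borel_measurable_indicator) auto
    then show ?thesis unfolding L_def case_prod_beta by measurable
  qed
  have L_le: "prob L \<le> 8 * b\<^sup>2 / (q\<^sup>2 * a\<^sup>2) / card A"
  proof -
    have "prob L \<le> 8 * (b * y)\<^sup>2 / (q\<^sup>2 * (a * y)\<^sup>2 * card A)"
      unfolding L_def using AB q ab y low up by (intro good_pairs_lower_tail) auto
    also have "\<dots> = 8 * b\<^sup>2 / (q\<^sup>2 * a\<^sup>2) / card A"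
      using y(1) by (simp add: power_mult_distrib)
    finally show ?thesis .
  qed
  have Q_le: "prob (Q g) \<le> K" if "g \<in> GG" for g
    unfolding Q_def K_def
  proof (rule hits_lower_tail[where b = b and B = B])
    fix u assume u: "u \<in> A"
    have pe0: "0 \<le> pe {u, v}" if "v \<in> {1..n}" "v \<noteq> u" for v
      using edge_prob[OF edge_in_complete[of u n v]] that u AB by fastforce
    have "(\<Sum>v\<in>B. pe {u, v}) \<le> (\<Sum>v\<in>{1..n} - {u}. pe {u, v})"
      using u AB pe0 by (intro sum_mono2) auto
    then show "(\<Sum>v\<in>B. pe {u, v}) \<le> b * y" using up[of u] u AB by fastforce
  next
    have "m = (q * (a * y) * card A / 2) / y / (1 + b)"
      using y(1) ab by (simp add: m_def field_simps)
    also have "\<dots> \<le> S g / y / (1 + b)"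
      using that y ab by (intro divide_right_mono) (auto simp: GG_def)
    finally show "m \<le> (\<Sum>(u, v)\<in>g. pe {u, v}) / y / (1 + b)" unfolding S_def .
  qed (use AB y m0 that in \<open>auto simp: GG_def\<close>)
  have sub: "{\<omega> \<in> space M. (\<Sum>u\<in>A. indicator (hit w (good_pairs A B d \<omega>) u) \<omega>) \<le> m / 2} \<subseteq> L \<union> (\<Union>g\<in>GG. P g \<inter> Q g)"
  proof clarify
    fix \<omega> assume w: "\<omega> \<in> space M" "(\<Sum>u\<in>A. indicator (hit w (good_pairs A B d \<omega>) u) \<omega>) \<le> m / 2"
      "\<omega> \<notin> (\<Union>g\<in>GG. P g \<inter> Q g)"
    let ?g = "good_pairs A B d \<omega>"
    have "\<omega> \<in> P ?g \<inter> Q ?g" using w by (simp add: P_def Q_def)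
    then have "?g \<notin> GG" using w(3) by blast
    then have "S ?g \<le> q * (a * y) * card A / 2" by (auto simp: GG_def good_pairs_def)
    moreover have "S ?g = (\<Sum>i\<in>A \<times> B. case i of (u, v) \<Rightarrow> pe {u, v} * indicator (good_pair d u v) \<omega>)"
      unfolding S_def using fin
      by (intro sum.mono_neutral_cong_left) (auto simp: good_pairs_def indicator_def split: if_splits)
    ultimately show "\<omega> \<in> L" using w(1) by (simp add: L_def)
  qed
  have PQ_ev: "P g \<inter> Q g \<in> events" if "g \<in> GG" for g
    using that P_grp mark_ev Q_grp edge_ev unfolding GG_def by (intro sets.Int) blast+
  then have U_ev: "(\<Union>g\<in>GG. P g \<inter> Q g) \<in> events" using finGG by (intro sets.finite_UN)
  then have N_ev: "L \<union> (\<Union>g\<in>GG. P g \<inter> Q g) \<in> events" using L_ev by (intro sets.Un)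
  have "prob (L \<union> (\<Union>g\<in>GG. P g \<inter> Q g)) \<le> prob L + prob (\<Union>g\<in>GG. P g \<inter> Q g)"
    using L_ev U_ev by (rule measure_Un_le)
  also have "prob (\<Union>g\<in>GG. P g \<inter> Q g) \<le> (\<Sum>g\<in>GG. prob (P g \<inter> Q g))"
    using finGG PQ_ev by (intro finite_measure_subadditive_finite) blast+
  also have "\<dots> = (\<Sum>g\<in>GG. prob (Q g) * prob (P g))"
  proof (rule sum.cong[OF refl])
    fix g assume "g \<in> GG"
    then have "prob (Q g \<inter> P g) = prob (Q g) * prob (P g)"
      using P_grp Q_grp
      by (intro prob_Int_groups[OF edge_mark_disjoint edge_index_subset mark_index_subset]) (auto simp: GG_def)
    then show "prob (P g \<inter> Q g) = prob (Q g) * prob (P g)" by (simp add: Int_commute)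
  qed
  also have "\<dots> \<le> (\<Sum>g\<in>GG. K * prob (P g))"
    by (intro sum_mono mult_right_mono Q_le) auto
  \<comment> \<open>The events \<open>P g\<close> are disjoint, so their probabilities sum to at
    most 1 and \<open>K\<close> is not multiplied by the number of sets \<open>g\<close>.\<close>
  also have "\<dots> = K * prob (\<Union>g\<in>GG. P g)"
  proof -
    have "disjoint_family_on P GG" unfolding disjoint_family_on_def P_def by blast
    moreover have "P ` GG \<subseteq> events" using P_grp mark_ev by blast
    ultimately have "prob (\<Union>g\<in>GG. P g) = (\<Sum>g\<in>GG. prob (P g))"
      using finGG by (intro finite_measure_finite_Union)
    then show ?thesis by (simp only: sum_distrib_left)
  qed
  also have "\<dots> \<le> K" by (intro mult_left_le) (auto simp: K_def)
  also have "K = 16 * (1 + b)\<^sup>2 / (q\<^sup>2 * a\<^sup>2) / card A"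
    using cA q ab by (simp add: K_def m_def power2_eq_square field_simps)
  finally have "prob (L \<union> (\<Union>g\<in>GG. P g \<inter> Q g))
      \<le> prob L + 16 * (1 + b)\<^sup>2 / (q\<^sup>2 * a\<^sup>2) / card A" by simp
  also have "\<dots> \<le> (8 * b\<^sup>2 + 16 * (1 + b)\<^sup>2) / (q\<^sup>2 * a\<^sup>2) / card A"
    using L_le by (simp add: add_divide_distrib)
  finally have N_le: "prob (L \<union> (\<Union>g\<in>GG. P g \<inter> Q g)) \<le> (8 * b\<^sup>2 + 16 * (1 + b)\<^sup>2) / (q\<^sup>2 * a\<^sup>2) / card A" .
  have "q * a / (4 * (1 + b)) * card A = m / 2" by (simp add: m_def)
  then show ?thesis by (intro bexI[OF _ N_ev] conjI N_le) (simp only: sub)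
qed

section \<open>Cost of a spanning tree\<close>

text \<open>One good edge for each vertex of \<open>A\<close> that is hit gives a star forest whose
  edges cost at least \<open>d * w\<close> each. It extends to a spanning tree, and the added edges
  have nonnegative cost.\<close>

lemma max_spanning_cost_ge:
  assumes \<omega>: "\<omega> \<in> space M" and d: "0 \<le> d" and w: "0 \<le> w"
    and AB: "A \<subseteq> {1..n}" "B \<subseteq> {1..n}" "\<And>u v. u \<in> A \<Longrightarrow> v \<in> B \<Longrightarrow> u < v"
    and conn: "connected_graph {1..n} (present_edges n Z \<omega>)"
    and tie: "tie (present_edges n Z \<omega>) = {1..n}"
  shows "(\<Sum>u\<in>A. indicator (hit w (good_pairs A B d \<omega>) u) \<omega>) * (d * w) \<le> max_spanning_cost n tie Z W X r \<omega>"
proof -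
  let ?E = "present_edges n Z \<omega>" and ?g = "good_pairs A B d \<omega>"
  let ?c = "edge_cost r X W \<omega>"
  define A' where "A' = {u \<in> A. \<omega> \<in> hit w ?g u}"
  have fin: "finite A" using AB by (auto intro: finite_subset)
  have E: "?E \<subseteq> complete_edges n" by (auto simp: present_edges_def)
  then have finE: "finite ?E" using finite_complete_edges finite_subset by blast
  have c0: "0 \<le> ?c h" if "h \<in> ?E" for h
  proof -
    have h: "h \<in> complete_edges n" using that E by blast
    then have "finite h" "h \<noteq> {}" "h \<subseteq> {1..n}" by (auto simp: complete_edges_def card_eq_0_iff intro: finite_subset)
    then have "Min h \<in> {1..n}" "Max h \<in> {1..n}" using Min_in Max_in by blast+
    then have "0 < r (X (Min h) \<omega>) (X (Max h) \<omega>)"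
      using measurable_space[OF X_measurable \<omega>] r_positive by blast
    then show ?thesis using W_positive[OF h \<omega>] by (simp add: edge_cost_def)
  qed
  have "\<forall>u\<in>A'. \<exists>v. (u, v) \<in> ?g \<and> \<omega> \<in> good_edge w {u, v}" by (auto simp: A'_def hit_def)
  then obtain f where f: "\<And>u. u \<in> A' \<Longrightarrow> (u, f u) \<in> ?g \<and> \<omega> \<in> good_edge w {u, f u}" by metis
  have f': "u \<in> A" "f u \<in> B" "u < f u" "\<omega> \<in> good_pair d u (f u)" if "u \<in> A'" for u
  proof -
    show *: "u \<in> A" "f u \<in> B" "\<omega> \<in> good_pair d u (f u)" using f[OF that] by (auto simp: good_pairs_def)
    show "u < f u" by (rule AB(3)[OF *(1,2)])
  qed
  let ?F = "(\<lambda>u. {u, f u}) ` A'"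
  have F_E: "?F \<subseteq> ?E"
  proof clarify
    fix u assume u: "u \<in> A'"
    have "{u, f u} \<in> complete_edges n" using f'(1-3)[OF u] AB(1,2) by (intro edge_in_complete) auto
    then show "{u, f u} \<in> ?E" using f[OF u] by (simp add: present_edges_def good_edge_def)
  qed
  have acyc: "\<nexists>vs. cycle_in ?F vs"
    using star_forest_acyclic[of A' f] f' AB(3) by (metis less_irrefl)
  have "\<Union>?E \<subseteq> {1..n}" using E by (auto simp: complete_edges_def)
  then obtain T where T: "?F \<subseteq> T" "T \<in> spanning_trees {1..n} ?E"
    using acyclic_extends_to_spanning_tree[OF finE F_E _ conn acyc] by blast
  have T_E: "T \<subseteq> ?E" using T(2) by (auto simp: spanning_trees_def)
  \<comment> \<open>\<open>f\<close> maps outside \<open>A\<close>, so different vertices have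
    different edges and no cost is counted twice.\<close>
  have inj: "inj_on (\<lambda>u. {u, f u}) A'"
    using f' AB(3) by (auto simp: inj_on_def doubleton_eq_iff) (metis less_irrefl)+
  have "(\<Sum>u\<in>A. indicator (hit w ?g u) \<omega>) * (d * w) = (\<Sum>u\<in>A'. d * w)"
    using fin by (simp add: A'_def indicator_def sum.If_cases Int_def)
  also have "\<dots> \<le> (\<Sum>u\<in>A'. ?c {u, f u})"
  proof (rule sum_mono)
    fix u assume u: "u \<in> A'"
    \<comment> \<open>The vertices of \<open>A\<close> precede those of \<open>B\<close>, so the
      arguments of \<open>r\<close> in \<open>edge_cost\<close> and in \<open>good_pair\<close> come
      in the same order.\<close>
    have "Min {u, f u} = u" "Max {u, f u} = f u" using f'(3)[OF u] by auto
    then show "d * w \<le> ?c {u, f u}"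
      using f[OF u] f'(4)[OF u] d w by (auto simp: edge_cost_def good_edge_def good_pair_def intro!: mult_mono)
  qed
  also have "\<dots> = (\<Sum>h\<in>?F. ?c h)" by (simp add: sum.reindex[OF inj])
  also have "\<dots> \<le> (\<Sum>h\<in>T. ?c h)"
    using T(1) T_E c0 finite_subset[OF T_E finE] by (intro sum_mono2) auto
  also have "\<dots> \<le> max_tree_cost ?c {1..n} ?E"
    unfolding max_tree_cost_def using T(2) finite_spanning_trees[OF finE] by (intro Max_ge) auto
  finally show ?thesis by (simp add: max_spanning_cost_def Let_def tie)
qed

text \<open>\<open>measure\<close> is 0 on a set that is not an event, so a lower bound calls for
  measurability. The event is a finite union over connected edge sets \<open>E\<close> and their
  spanning trees \<open>T\<close>.\<close>

lemma connected_cost_event: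
  assumes tie: "\<And>E. E \<subseteq> complete_edges n \<Longrightarrow> connected_graph {1..n} E \<Longrightarrow> tie E = {1..n}"
  shows "{\<omega> \<in> space M. connected_graph {1..n} (present_edges n Z \<omega>) \<and>
      k \<le> max_spanning_cost n tie Z W X r \<omega>} \<in> events"
proof -
  define Q where "Q E T = {\<omega> \<in> space M. (\<forall>h\<in>complete_edges n. (Z h \<omega> = 1) = (h \<in> E)) \<and> k \<le> (\<Sum>h\<in>T. edge_cost r X W \<omega> h)}" for E T
  let ?EE = "{E. E \<subseteq> complete_edges n \<and> connected_graph {1..n} E}"
  have fin: "finite ?EE" using finite_complete_edges by simp
  have Q_ev: "Q E T \<in> events" if "T \<subseteq> complete_edges n" for E T
  proof -
    have cost: "(\<lambda>\<omega>. edge_cost r X W \<omega> h) \<in> borel_measurable M" if hT: "h \<in> T" for h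
    proof -
      have h: "h \<in> complete_edges n" using hT \<open>T \<subseteq> complete_edges n\<close> by blast
      then have "finite h" "h \<noteq> {}" "h \<subseteq> {1..n}" by (auto simp: complete_edges_def card_eq_0_iff intro: finite_subset)
      then have "Min h \<in> {1..n}" "Max h \<in> {1..n}" using Min_in Max_in by blast+
      note [measurable] = X_measurable[OF this(1)] X_measurable[OF this(2)] W_measurable[OF h] r_measurable
      have "(\<lambda>\<omega>. case_prod r (X (Min h) \<omega>, X (Max h) \<omega>) * W h \<omega>) \<in> borel_measurable M" by measurable
      then show ?thesis by (simp add: edge_cost_def)
    qed
    have "{\<omega> \<in> space M. (Z h \<omega> = 1) = (h \<in> E)} \<in> events" if h: "h \<in> complete_edges n" for h
    proof -
      note Z_measurable[OF h, measurable]
      show ?thesis by measurable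
    qed
    then have "{\<omega> \<in> space M. \<forall>h\<in>complete_edges n. (Z h \<omega> = 1) = (h \<in> E)} \<in> events"
      by (rule sets.sets_Collect_finite_All[OF _ finite_complete_edges])
    moreover have "{\<omega> \<in> space M. k \<le> (\<Sum>h\<in>T. edge_cost r X W \<omega> h)} \<in> events"
      by (intro borel_measurable_le borel_measurable_const borel_measurable_sum cost)
    ultimately show ?thesis unfolding Q_def by (intro sets.sets_Collect_conj)
  qed
  have "{\<omega> \<in> space M. connected_graph {1..n} (present_edges n Z \<omega>) \<and>
      k \<le> max_spanning_cost n tie Z W X r \<omega>} = (\<Union>E\<in>?EE. \<Union>T\<in>spanning_trees {1..n} E. Q E T)"
  proof -
    have eq: "present_edges n Z \<omega> = E \<longleftrightarrow> (\<forall>h\<in>complete_edges n. (Z h \<omega> = 1) = (h \<in> E))"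
      if "E \<subseteq> complete_edges n" for E \<omega>
      using that unfolding present_edges_def by blast
    have mx: "k \<le> max_spanning_cost n tie Z W X r \<omega> \<longleftrightarrow> (\<exists>T\<in>spanning_trees {1..n} E. k \<le> (\<Sum>h\<in>T. edge_cost r X W \<omega> h))"
      if "present_edges n Z \<omega> = E" "E \<in> ?EE" for \<omega> E
    proof -
      have finE: "finite E" using that finite_complete_edges finite_subset by blast
      have "\<Union>E \<subseteq> {1..n}" using that by (auto simp: complete_edges_def)
      \<comment> \<open>The empty forest extends to a spanning tree, so the maximum runs over a
        nonempty finite set and is attained.\<close>
      moreover have "\<nexists>vs. cycle_in {} vs"
        by (metis star_forest_acyclic[of "{}"] empty_iff image_empty)
      ultimately have "spanning_trees {1..n} E \<noteq> {}"
        using acyclic_extends_to_spanning_tree[OF finE, of "{}" "{1..n}"] that(2) by (metis (no_types, lifting) emptyE empty_subsetI mem_Collect_eq)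
      moreover have "max_spanning_cost n tie Z W X r \<omega> = max_tree_cost (edge_cost r X W \<omega>) {1..n} E"
        using that tie by (simp add: max_spanning_cost_def)
      ultimately show ?thesis
        using finite_spanning_trees[OF finE] by (simp add: max_tree_cost_def Max_ge_iff)
    qed
    show ?thesis
    proof (intro equalityI subsetI)
      fix \<omega> assume "\<omega> \<in> {\<omega> \<in> space M. connected_graph {1..n} (present_edges n Z \<omega>) \<and>
        k \<le> max_spanning_cost n tie Z W X r \<omega>}"
      then have w: "\<omega> \<in> space M" "connected_graph {1..n} (present_edges n Z \<omega>)" "k \<le> max_spanning_cost n tie Z W X r \<omega>"
        by auto
      have E: "present_edges n Z \<omega> \<in> ?EE" using w(2) by (auto simp: present_edges_def)
      then obtain T where "T \<in> spanning_trees {1..n} (present_edges n Z \<omega>)" "k \<le> (\<Sum>h\<in>T. edge_cost r X W \<omega> h)"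
        using mx[OF refl E] w(3) by blast
      moreover have "\<forall>h\<in>complete_edges n. (Z h \<omega> = 1) = (h \<in> present_edges n Z \<omega>)"
        by (simp add: present_edges_def)
      ultimately show "\<omega> \<in> (\<Union>E\<in>?EE. \<Union>T\<in>spanning_trees {1..n} E. Q E T)"
        using E w(1) unfolding Q_def by blast
    next
      fix \<omega> assume "\<omega> \<in> (\<Union>E\<in>?EE. \<Union>T\<in>spanning_trees {1..n} E. Q E T)"
      then obtain E T where ET: "E \<in> ?EE" "T \<in> spanning_trees {1..n} E" "\<omega> \<in> Q E T" by blast
      then have pres: "present_edges n Z \<omega> = E" using eq[of E \<omega>] by (simp add: Q_def)
      then have "k \<le> max_spanning_cost n tie Z W X r \<omega>" using mx[OF pres ET(1)] ET(2,3) by (auto simp: Q_def)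
      then show "\<omega> \<in> {\<omega> \<in> space M. connected_graph {1..n} (present_edges n Z \<omega>) \<and>
        k \<le> max_spanning_cost n tie Z W X r \<omega>}"
        using ET(1,3) pres by (simp add: Q_def)
    qed
  qed
  also have "\<dots> \<in> events"
  proof (intro sets.finite_UN fin)
    fix E assume E: "E \<in> ?EE"
    then have "finite E" using finite_complete_edges finite_subset by blast
    then show "finite (spanning_trees {1..n} E)" by (rule finite_spanning_trees)
    fix T assume "T \<in> spanning_trees {1..n} E"
    then have "T \<subseteq> complete_edges n" using E by (auto simp: spanning_trees_def)
    then show "Q E T \<in> events" by (rule Q_ev)
  qed
  finally show ?thesis .
qed

section \<open>The bound for a fixed number of vertices\<close>

lemma weight_law:
  assumes "2 \<le> n"
  shows "real_distribution \<mu>" "measure \<mu> {..0} = 0"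
proof -
  \<comment> \<open>Some edge is needed to reach the common law \<open>\<mu>\<close>;
    \<open>{1, 2}\<close> exists as \<open>n \<ge> 2\<close>.\<close>
  have h: "{1, 2} \<in> complete_edges n" using assms by (intro edge_in_complete) auto
  show "real_distribution \<mu>"
    unfolding W_law[OF h, symmetric] using W_measurable[OF h] by (rule real_distribution_distr)
  have "W {1, 2} -` {..0} \<inter> space M = {}" using W_positive[OF h] by (auto simp: not_le[symmetric])
  then show "measure \<mu> {..0} = 0"
    unfolding W_law[OF h, symmetric] using W_measurable[OF h] by (subst measure_distr) auto
qed

lemma prob_good_pair_ge:
  assumes "2 \<le> n" "u \<in> {1..n}" "v \<in> {1..n}" "u \<noteq> v"
    and int: "integrable M (\<lambda>\<omega>. (r (X 1 \<omega>) (X 2 \<omega>))\<^sup>2)"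
    and l: "0 < l" "l \<le> (expectation (\<lambda>\<omega>. r (X 1 \<omega>) (X 2 \<omega>)))\<^sup>2"
    and U: "expectation (\<lambda>\<omega>. (r (X 1 \<omega>) (X 2 \<omega>))\<^sup>2) \<le> U"
  shows "l / (4 * U) \<le> prob (good_pair (sqrt l / 2) u v)"
proof -
  have 12: "1 \<in> {1..n}" "2 \<in> {1..n}" using assms by auto
  note [measurable] = X_measurable[OF 12(1)] X_measurable[OF 12(2)] r_measurable
  have "(\<lambda>\<omega>. case_prod r (X 1 \<omega>, X 2 \<omega>)) \<in> borel_measurable M" by measurable
  then have "l / (4 * U) \<le> prob {\<omega> \<in> space M. sqrt l / 2 \<le> r (X 1 \<omega>) (X 2 \<omega>)}"
    using measurable_space[OF X_measurable] r_positive 12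
    by (intro paley_zygmund_half int l U) (auto intro!: less_imp_le)
  also have "\<dots> = prob (good_pair (sqrt l / 2) 1 2)" by (simp add: good_pair_def)
  also have "\<dots> = prob (good_pair (sqrt l / 2) u v)" using 12 assms by (intro prob_good_pair) auto
  finally show ?thesis .
qed

text \<open>Apart from two events of probability of order \<open>1 / n\<close>, disconnection and
  too few hits, the star forest yields the cost.\<close>

lemma connected_cost_lower:
  assumes n: "2 \<le> n"
    and tie: "\<And>E. E \<subseteq> complete_edges n \<Longrightarrow> largest_component {1..n} E (tie E)"
    and ab: "0 < a" "0 < b" and y: "1 < y"
    and low: "\<And>u S. u \<in> {1..n} \<Longrightarrow> S \<subseteq> {1..n} \<Longrightarrow> real n / 2 \<le> real (card S) \<Longrightarrow>
      a * y \<le> (\<Sum>v\<in>S - {u}. pe {u, v})"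
    and up: "\<And>u. u \<in> {1..n} \<Longrightarrow> (\<Sum>v\<in>{1..n} - {u}. pe {u, v}) \<le> b * y"
    and d: "0 < d" and q: "0 < q" "\<And>u v. u \<in> {1..n} \<Longrightarrow> v \<in> {1..n} \<Longrightarrow> u \<noteq> v \<Longrightarrow> q \<le> prob (good_pair d u v)"
    and ln: "2 * ln (real n) \<le> a * y"
  shows "1 - (2 + 3 * ((8 * b\<^sup>2 + 16 * (1 + b)\<^sup>2) / (q\<^sup>2 * a\<^sup>2))) / real n
    \<le> prob {\<omega> \<in> space M. connected_graph {1..n} (present_edges n Z \<omega>) \<and>
        q * a / (4 * (1 + b)) * d / 6 * real n * ccdf_inverse \<mu> y \<le> max_spanning_cost n tie Z W X r \<omega>}"
proof -
  \<comment> \<open>All of \<open>A\<close> lies below all of \<open>B\<close>. As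
    \<open>n \<ge> 2\<close>, \<open>A\<close> has at least \<open>n / 3\<close> vertices;
    \<open>B\<close> has at least \<open>n / 2\<close>, enough for \<open>low\<close>.\<close>
  define A where "A = {1..n div 2}"
  define B where "B = {Suc (n div 2)..n}"
  define H where "H = ccdf_inverse \<mu> y"
  define \<kappa> where "\<kappa> = q * a / (4 * (1 + b))"
  define K where "K = (8 * b\<^sup>2 + 16 * (1 + b)\<^sup>2) / (q\<^sup>2 * a\<^sup>2)"
  define Ev where "Ev = {\<omega> \<in> space M. connected_graph {1..n} (present_edges n Z \<omega>) \<and>
        \<kappa> * d / 6 * real n * H \<le> max_spanning_cost n tie Z W X r \<omega>}"
  have H: "0 < H" "1 / y \<le> ccdf \<mu> (H / 2)"
    unfolding H_def by (rule ccdf_inverse_half[OF weight_law[OF n] y])+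
  have \<kappa>: "0 < \<kappa>" using q ab by (simp add: \<kappa>_def)
  have K0: "0 \<le> K" by (simp add: K_def)
  have AB: "A \<subseteq> {1..n}" "B \<subseteq> {1..n}" "A \<inter> B = {}" "A \<noteq> {}" "\<And>u v. u \<in> A \<Longrightarrow> v \<in> B \<Longrightarrow> u < v"
    using n by (auto simp: A_def B_def)
  have "n \<le> 3 * (n div 2)" using n by linarith
  then have cA: "real n / 3 \<le> real (card A)" by (simp add: A_def)
  have cA0: "0 < real (card A)" using n cA by linarith
  have "n \<le> 2 * (n - n div 2)" by linarith
  then have cB: "real n / 2 \<le> real (card B)" by (simp add: B_def)
  have tie_eq: "tie E = {1..n}" if "E \<subseteq> complete_edges n" "connected_graph {1..n} E" for E
    using connected_largest_component[OF that(2) tie[OF that(1)]] .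
  have Ev: "Ev \<in> events" unfolding Ev_def by (rule connected_cost_event) (fact tie_eq)
  obtain N1 where N1: "N1 \<in> events" "{\<omega> \<in> space M. \<not> connected_graph {1..n} (present_edges n Z \<omega>)} \<subseteq> N1"
      "prob N1 \<le> (1 + exp (- (a * y))) ^ n - 1"
    using prob_disconnected_le[of "a * y", OF low] by blast
  \<comment> \<open>Here \<open>ln\<close> is the hypothesis that makes each vertex's factor in the
    union bound at most \<open>1 / (real n)\<^sup>2\<close>.\<close>
  have "exp (- (a * y)) \<le> exp (- (2 * ln (real n)))" using ln by simp
  also have "\<dots> = 1 / (real n)\<^sup>2"
    using n by (simp add: exp_minus inverse_eq_divide exp_of_nat_mult[of 2 "ln (real n)", simplified])
  finally have "(1 + exp (- (a * y))) ^ n - 1 \<le> 2 / real n"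
    using n by (intro one_plus_power_minus_one_le) auto
  then have N1': "prob N1 \<le> 2 / real n" using N1(3) by linarith
  have low': "a * y \<le> (\<Sum>v\<in>B. pe {u, v})" if "u \<in> A" for u
  proof -
    have "B - {u} = B" using AB that by auto
    then show ?thesis using low[of u B] cB AB that by auto
  qed
  have "\<exists>N\<in>events. {\<omega> \<in> space M. (\<Sum>u\<in>A. indicator (hit (H / 2) (good_pairs A B d \<omega>) u) \<omega>) \<le> q * a / (4 * (1 + b)) * card A} \<subseteq> N \<and>
     prob N \<le> (8 * b\<^sup>2 + 16 * (1 + b)\<^sup>2) / (q\<^sup>2 * a\<^sup>2) / card A"
  proof (rule prob_hits_bad_le[where y = y])
    fix u v assume uv: "u \<in> A" "v \<in> B"
    then have "u \<in> {1..n}" "v \<in> {1..n}" "u \<noteq> v" using AB by auto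
    then show "q \<le> prob (good_pair d u v)" by (rule q)
  qed (use AB q ab y H low' up in auto)
  then obtain N2 where N2: "N2 \<in> events" "{\<omega> \<in> space M. (\<Sum>u\<in>A. indicator (hit (H / 2) (good_pairs A B d \<omega>) u) \<omega>) \<le> \<kappa> * card A} \<subseteq> N2"
      "prob N2 \<le> K / card A"
    unfolding \<kappa>_def K_def by blast
  have "K / card A \<le> K / (real n / 3)" using K0 cA cA0 n by (intro divide_left_mono) auto
  then have N2': "prob N2 \<le> 3 * K / real n" using N2(3) by (simp add: mult.commute)
  have "space M - Ev \<subseteq> N1 \<union> N2"
  proof (rule subsetI, rule ccontr)
    fix \<omega> assume w: "\<omega> \<in> space M - Ev" "\<omega> \<notin> N1 \<union> N2"
    let ?T = "\<Sum>u\<in>A. indicator (hit (H / 2) (good_pairs A B d \<omega>) u) \<omega> :: real"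
    have conn: "connected_graph {1..n} (present_edges n Z \<omega>)" using w N1(2) by blast
    have T: "\<kappa> * card A < ?T"
    proof (rule ccontr)
      assume "\<not> \<kappa> * card A < ?T"
      then have "\<omega> \<in> {\<omega> \<in> space M. (\<Sum>u\<in>A. indicator (hit (H / 2) (good_pairs A B d \<omega>) u) \<omega>) \<le> \<kappa> * card A}"
        using w by simp
      then show False using N2(2) w by blast
    qed
    \<comment> \<open>The \<open>6\<close> is \<open>3 * 2\<close>: \<open>A\<close> has at least
      \<open>n / 3\<close> vertices and the weight threshold is \<open>H / 2\<close>.\<close>
    have "\<kappa> * d / 6 * real n * H = \<kappa> * (real n / 3) * (d * (H / 2))" by simp
    also have "\<dots> \<le> \<kappa> * card A * (d * (H / 2))"
      using \<kappa> d H cA by (intro mult_right_mono mult_left_mono) auto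
    also have "\<dots> \<le> ?T * (d * (H / 2))" using T d H by (intro mult_right_mono) auto
    also have "\<dots> \<le> max_spanning_cost n tie Z W X r \<omega>"
    proof (rule max_spanning_cost_ge)
      show "tie (present_edges n Z \<omega>) = {1..n}"
        using conn by (intro tie_eq) (auto simp: present_edges_def)
    qed (use w d H AB conn in auto)
    finally show False using w conn by (simp add: Ev_def)
  qed
  then have "prob (space M - Ev) \<le> prob (N1 \<union> N2)" using N1 N2 by (intro finite_measure_mono) auto
  also have "\<dots> \<le> prob N1 + prob N2" using N1 N2 by (intro measure_Un_le) auto
  also have "\<dots> \<le> (2 + 3 * K) / real n" using N1' N2' by (simp add: add_divide_distrib)
  finally have "1 - (2 + 3 * K) / real n \<le> prob Ev" using prob_compl[OF Ev] by simp
  then show ?thesis unfolding Ev_def \<kappa>_def K_def H_def .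
qed

end

section \<open>The choice of the constant, uniformly in the number of vertices\<close>

theorem theorem1:
  fixes M :: "nat \<Rightarrow> 'w measure"
    and pe :: "nat \<Rightarrow> nat set \<Rightarrow> real"
    and Z :: "nat \<Rightarrow> nat set \<Rightarrow> 'w \<Rightarrow> nat"
    and \<mu> :: "real measure"
    and W :: "nat \<Rightarrow> nat set \<Rightarrow> 'w \<Rightarrow> real"
    and MK :: "'k measure"
    and X :: "nat \<Rightarrow> nat \<Rightarrow> 'w \<Rightarrow> 'k"
    and r :: "nat \<Rightarrow> 'k \<Rightarrow> 'k \<Rightarrow> real"
    and tie :: "nat \<Rightarrow> nat set set \<Rightarrow> nat set"
    and p :: "nat \<Rightarrow> real"
    and a\<^sub>0 b\<^sub>0 \<gamma>\<^sub>0 \<delta>\<^sub>l\<^sub>o\<^sub>w \<delta>\<^sub>u\<^sub>p :: real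
  assumes model: "\<And>n. n \<ge> 2 \<Longrightarrow>
      weighted_random_graph (M n) n (pe n) (Z n) \<mu> (W n) MK (X n) (r n)"
    and tie: "\<And>n E. n \<ge> 2 \<Longrightarrow> E \<subseteq> complete_edges n \<Longrightarrow> largest_component {1..n} E (tie n E)"
    and "a\<^sub>0 > 0" and "b\<^sub>0 > 0" and "0 < \<gamma>\<^sub>0" and "\<gamma>\<^sub>0 < 1 / 2"
    and "\<And>n. n \<ge> 2 \<Longrightarrow> 0 < p n \<and> p n < 1"
    and edge_sums: "\<forall>\<^sub>F n in sequentially. \<forall>u\<in>{1..n}. \<forall>S\<subseteq>{1..n}. \<gamma>\<^sub>0 * real n \<le> real (card S) \<longrightarrow>
          a\<^sub>0 * real n * p n \<le> (\<Sum>v\<in>S - {u}. pe n {u, v}) \<and>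
          (\<Sum>v\<in>S - {u}. pe n {u, v}) \<le> (\<Sum>v\<in>{1..n} - {u}. pe n {u, v}) \<and>
          (\<Sum>v\<in>{1..n} - {u}. pe n {u, v}) \<le> b\<^sub>0 * real n * p n"
    and ccdf_cont: "\<forall>\<^sub>F x in at_top. isCont (ccdf \<mu>) x"
    and "\<delta>\<^sub>l\<^sub>o\<^sub>w > 0" and "\<delta>\<^sub>u\<^sub>p > 0"
    and cost_factor: "\<And>n. n \<ge> 2 \<Longrightarrow>
          integrable (M n) (\<lambda>\<omega>. (r n (X n 1 \<omega>) (X n 2 \<omega>))\<^sup>2) \<and>
          \<delta>\<^sub>l\<^sub>o\<^sub>w \<le> (\<integral>\<omega>. r n (X n 1 \<omega>) (X n 2 \<omega>) \<partial>M n)\<^sup>2 \<and>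
          (\<integral>\<omega>. r n (X n 1 \<omega>) (X n 2 \<omega>) \<partial>M n)\<^sup>2 \<le> (\<integral>\<omega>. (r n (X n 1 \<omega>) (X n 2 \<omega>))\<^sup>2 \<partial>M n) \<and>
          (\<integral>\<omega>. (r n (X n 1 \<omega>) (X n 2 \<omega>))\<^sup>2 \<partial>M n) \<le> \<delta>\<^sub>u\<^sub>p"
  shows "\<exists>C>0. \<forall>n\<ge>2. p n \<ge> C * ln (real n) / real n \<longrightarrow>
     measure (M n) {\<omega> \<in> space (M n).
        connected_graph {1..n} (present_edges n (Z n) \<omega>) \<and>
        max_spanning_cost n (tie n) (Z n) (W n) (X n) (r n) \<omega>
          \<ge> inverse C * real n * ccdf_inverse \<mu> (real n * p n)}
     \<ge> 1 - C / real n"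
proof -
  \<comment> \<open>\<open>q\<close> and \<open>d\<close> are the probability and the threshold of
    the Paley-Zygmund bound.\<close>
  define q where "q = \<delta>\<^sub>l\<^sub>o\<^sub>w / (4 * \<delta>\<^sub>u\<^sub>p)"
  define d where "d = sqrt \<delta>\<^sub>l\<^sub>o\<^sub>w / 2"
  define \<kappa> where "\<kappa> = q * a\<^sub>0 / (4 * (1 + b\<^sub>0)) * d / 6"
  define K where "K = 2 + 3 * ((8 * b\<^sub>0\<^sup>2 + 16 * (1 + b\<^sub>0)\<^sup>2) / (q\<^sup>2 * a\<^sub>0\<^sup>2))"
  have q0: "0 < q" using \<open>\<delta>\<^sub>l\<^sub>o\<^sub>w > 0\<close> \<open>\<delta>\<^sub>u\<^sub>p > 0\<close> by (simp add: q_def)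
  have d0: "0 < d" using \<open>\<delta>\<^sub>l\<^sub>o\<^sub>w > 0\<close> by (simp add: d_def)
  have \<kappa>0: "0 < \<kappa>" using q0 d0 \<open>a\<^sub>0 > 0\<close> \<open>b\<^sub>0 > 0\<close> by (simp add: \<kappa>_def)
  have K0: "0 \<le> K" by (simp add: K_def)
  obtain n0 where n0: "\<And>n u S. n0 \<le> n \<Longrightarrow> u \<in> {1..n} \<Longrightarrow> S \<subseteq> {1..n} \<Longrightarrow> \<gamma>\<^sub>0 * real n \<le> real (card S) \<Longrightarrow>
      a\<^sub>0 * real n * p n \<le> (\<Sum>v\<in>S - {u}. pe n {u, v}) \<and> (\<Sum>v\<in>{1..n} - {u}. pe n {u, v}) \<le> b\<^sub>0 * real n * p n"
    using edge_sums unfolding eventually_sequentially by blast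
  \<comment> \<open>Each summand serves one requirement: \<open>2\<close> gives
    \<open>y > 1\<close>, \<open>n0\<close> the range where \<open>edge_sums\<close> holds,
    \<open>2 / a\<^sub>0\<close> connectedness, \<open>1 / \<kappa>\<close> the cost and
    \<open>K\<close> the error probability.\<close>
  define C where "C = 2 + real n0 + 2 / a\<^sub>0 + 1 / \<kappa> + K"
  have "0 < 2 / a\<^sub>0" "0 < 1 / \<kappa>" using \<open>a\<^sub>0 > 0\<close> \<kappa>0 by simp_all
  then have C: "2 \<le> C" "real n0 \<le> C" "2 / a\<^sub>0 \<le> C" "1 / \<kappa> \<le> C" "K \<le> C"
    using K0 unfolding C_def by linarith+
  have "1 - C / real n \<le> measure (M n) {\<omega> \<in> space (M n).
        connected_graph {1..n} (present_edges n (Z n) \<omega>) \<and>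
        max_spanning_cost n (tie n) (Z n) (W n) (X n) (r n) \<omega>
          \<ge> inverse C * real n * ccdf_inverse \<mu> (real n * p n)}"
    if n: "2 \<le> n" and pn: "C * ln (real n) / real n \<le> p n" for n
  \<comment> \<open>For \<open>n < C\<close> the claimed lower bound is negative; otherwise
    \<open>n \<ge> n0\<close>.\<close>
  proof (cases "real n < C")
    case True
    then have "1 - C / real n \<le> 0" using n by (simp add: field_simps)
    then show ?thesis using measure_nonneg order_trans by blast
  next
    case False
    then have nn: "n0 \<le> n" using C(2) by linarith
    interpret weighted_random_graph "M n" n "pe n" "Z n" \<mu> "W n" MK "X n" "r n" by (rule model[OF n])
    define y where "y = real n * p n"
    have y_ge: "C * ln (real n) \<le> y" using pn n by (simp add: y_def field_simps)
    \<comment> \<open>With \<open>C \<ge> 2\<close> this gives \<open>y \<ge> 4 / 3\<close>, so that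
      \<open>ccdf_inverse \<mu> y\<close> is meaningful.\<close>
    have ln0: "2 / 3 \<le> ln (real n)"
      using ln2_ge_two_thirds n by (intro order_trans[OF ln2_ge_two_thirds]) auto
    have "4 / 3 \<le> C * ln (real n)" using mult_mono[OF C(1) ln0] C(1) by simp
    then have y1: "1 < y" using y_ge by linarith
    have "2 / a\<^sub>0 * ln (real n) \<le> y" using mult_right_mono[OF C(3), of "ln (real n)"] ln0 y_ge by linarith
    then have ay: "2 * ln (real n) \<le> a\<^sub>0 * y" using \<open>a\<^sub>0 > 0\<close> by (simp add: field_simps)
    \<comment> \<open>Since \<open>\<gamma>\<^sub>0 < 1 / 2\<close>, every set of at least half of
      the vertices qualifies for \<open>edge_sums\<close>.\<close>
    have g: "\<gamma>\<^sub>0 * real n \<le> real n / 2" using \<open>\<gamma>\<^sub>0 < 1 / 2\<close> n by simp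
    let ?Ev = "\<lambda>k. {\<omega> \<in> space (M n). connected_graph {1..n} (present_edges n (Z n) \<omega>) \<and>
        k * real n * ccdf_inverse \<mu> y \<le> max_spanning_cost n (tie n) (Z n) (W n) (X n) (r n) \<omega>}"
    have tie_eq: "tie n E = {1..n}" if "E \<subseteq> complete_edges n" "connected_graph {1..n} E" for E
      using connected_largest_component[OF that(2) tie[OF n that(1)]] .
    have "1 - K / real n \<le> prob (?Ev \<kappa>)"
      unfolding K_def \<kappa>_def
    proof (rule connected_cost_lower[OF n tie[OF n] \<open>a\<^sub>0 > 0\<close> \<open>b\<^sub>0 > 0\<close> y1])
      fix u S assume "u \<in> {1..n}" "S \<subseteq> {1..n}" "real n / 2 \<le> real (card S)"
      then show "a\<^sub>0 * y \<le> (\<Sum>v\<in>S - {u}. pe n {u, v})"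
        using n0[OF nn, of u S] g by (simp add: y_def mult.assoc)
    next
      fix u assume "u \<in> {1..n}"
      then show "(\<Sum>v\<in>{1..n} - {u}. pe n {u, v}) \<le> b\<^sub>0 * y"
        using n0[OF nn, of u "{1..n}"] g by (simp add: y_def mult.assoc)
    next
      fix u v assume "u \<in> {1..n}" "v \<in> {1..n}" "u \<noteq> v"
      then show "q \<le> prob (good_pair d u v)"
        unfolding q_def d_def using n cost_factor[OF n] \<open>\<delta>\<^sub>l\<^sub>o\<^sub>w > 0\<close> by (intro prob_good_pair_ge) auto
    qed (assumption | fact d0 q0 ay)+
    also have "prob (?Ev \<kappa>) \<le> prob (?Ev (inverse C))"
    proof (rule finite_measure_mono)
      have H: "0 < ccdf_inverse \<mu> y" by (rule ccdf_inverse_half(1)[OF weight_law[OF n] y1])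
      have "inverse C \<le> \<kappa>"
        using C(4) \<kappa>0 C(1) by (simp add: field_simps)
      then have "inverse C * real n * ccdf_inverse \<mu> y \<le> \<kappa> * real n * ccdf_inverse \<mu> y"
        using H by (intro mult_right_mono) auto
      then show "?Ev \<kappa> \<subseteq> ?Ev (inverse C)" by auto
      show "?Ev (inverse C) \<in> events" by (rule connected_cost_event) (fact tie_eq)
    qed
    finally have "1 - K / real n \<le> prob (?Ev (inverse C))" .
    moreover have "K / real n \<le> C / real n" using C(5) by (intro divide_right_mono) auto
    ultimately show ?thesis unfolding y_def by linarith
  qed
  then show ?thesis using C(1) by (intro exI[of _ C]) auto
qed

end
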